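(* Assume that there is $N_0>0$ such that $\rho_k$ is nondecreasing in $k>N_0$, and that $\rho_k\to1$ as $k\to\infty$. (1) If $\sum_{n=2}^\infty \frac{1}{D(n)\log n}<\infty$ (with the convention $1/\infty=0$), then for each integer $a\ge1$, each $A\subseteq\{a,a+1,\dots\}$ and each $B\subseteq\{1,2,\dots,a\}$, almost surely $|C(A,a)|<\infty$, $|C(a,B)|<\infty$ and $|C_w|<\infty$. (2) If there exist $n_0>0$ and $\delta>0$ such that $D(n)\le\delta n\log n$ for all $n\ge n_0$, and $\sum_{n=2}^\infty \frac{1}{D(n)\log n}=\infty$, then for each integer $a\ge1$, each nonempty $A\subseteq\{a,a+1,\dots\}$ and each nonempty $B\subseteq\{1,2,\dots,a\}$, almost surely $|C(A,a)|=\infty$, $|C(a,B)|=\infty$ and $|C_w|=\infty$.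
   Context: Let $p_0=1$, $q_0=0$, and for $k\ge1$ let $p_k,q_k>0$ with $p_k+q_k=1$. Let $X=(X_k)_{k\ge0}$ be the Markov chain on $\mathbb Z_+=\{0,1,2,\dots\}$ with $X_0=0$ and transition probabilities $\mathbb P(X_{k+1}=n+1\mid X_k=n)=p_n$, $\mathbb P(X_{k+1}=n-1\mid X_k=n)=q_n$ for $n\ge0$. Let $\rho_k=q_k/p_k$ for $k\ge1$. For integers $n\ge m\ge0$ let $D(m,n)=0$ if $n=m$, $D(m,n)=1$ if $n=m+1$, and $D(m,n)=1+\sum_{j=1}^{n-m-1}\rho_{m+1}\cdots\rho_{m+j}$ if $n\ge m+2$; let $D(m)=\lim_{n\to\infty}D(m,n)\in[1,\infty]$. (It is known that $X$ is transient iff $D(0)<\infty$.) For $x\in\mathbb Z_+$ let $\xi(x)=\sum_{k\ge0}1_{\{X_k=x\}}$ (local time) and $\xi(x,\uparrow)=\sum_{k\ge0}1_{\{X_k=x,X_{k+1}=x+1\}}$ (upcrossing time). For $A,B\subseteq\{1,2,\dots\}$ let $C(A,B)=\{x\in\mathbb Z_+:\xi(x)\in A,\ \xi(x,\uparrow)\in B\}$; write $C(a,B)=C(\{a\},B)$, $C(A,b)=C(A,\{b\})$, $C(a,b)=C(\{a\},\{b\})$. A site $R\in\mathbb Z_+$ is a weak cutpoint if for some $k$ we have $X_k=R$, $X_i\le R$ for $0\le i\le k-1$, and $X_i\ge R$ for all $i\ge k+1$; $C_w$ denotes the set of weak cutpoints. $|C|$ is the cardinality of $C$. *)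

theory Defs
  imports "HOL-Probability.Probability"
begin

text \<open>Birth-death chain on the nonnegative integers with up-probabilities p k,
  down-probabilities q k = 1 - p k, p 0 = 1.\<close>

definition rho :: "(nat \<Rightarrow> real) \<Rightarrow> nat \<Rightarrow> real" where
  "rho p k = (1 - p k) / p k"

definition Dmn :: "(nat \<Rightarrow> real) \<Rightarrow> nat \<Rightarrow> nat \<Rightarrow> real" where
  "Dmn p m n = (if n = m then 0
     else 1 + (\<Sum>j\<in>{1..n - m - 1}. \<Prod>i\<in>{m+1..m+j}. rho p i))"

text \<open>D(m) = lim of D(m,n) as n tends to infinity (nondecreasing in n), in [1,\<infinity>]\<close>
definition Dinf :: "(nat \<Rightarrow> real) \<Rightarrow> nat \<Rightarrow> ereal" where
  "Dinf p m = (SUP n\<in>{m..}. ereal (Dmn p m n))"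

definition Dterm :: "(nat \<Rightarrow> real) \<Rightarrow> nat \<Rightarrow> real" where
  "Dterm p n = (if Dinf p n = \<infinity> then 0 else 1 / (real_of_ereal (Dinf p n) * ln (real n)))"

definition bd_chain :: "'a measure \<Rightarrow> (nat \<Rightarrow> real) \<Rightarrow> (nat \<Rightarrow> 'a \<Rightarrow> nat) \<Rightarrow> bool" where
  "bd_chain M p X \<longleftrightarrow>
     prob_space M \<and>
     (\<forall>k. X k \<in> measurable M (count_space UNIV)) \<and>
     (\<forall>\<omega>\<in>space M. X 0 \<omega> = 0) \<and>
     (\<forall>k h. measure M {\<omega>\<in>space M. (\<forall>i\<le>k. X i \<omega> = h i) \<and> X (Suc k) \<omega> = Suc (h k)}
             = p (h k) * measure M {\<omega>\<in>space M. \<forall>i\<le>k. X i \<omega> = h i}) \<and>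
     (\<forall>k h. 0 < h k \<longrightarrow>
             measure M {\<omega>\<in>space M. (\<forall>i\<le>k. X i \<omega> = h i) \<and> X (Suc k) \<omega> = h k - 1}
             = (1 - p (h k)) * measure M {\<omega>\<in>space M. \<forall>i\<le>k. X i \<omega> = h i})"

definition Cset :: "(nat \<Rightarrow> 'a \<Rightarrow> nat) \<Rightarrow> nat set \<Rightarrow> nat set \<Rightarrow> 'a \<Rightarrow> nat set" where
  "Cset X A B \<omega> = {x. finite {k. X k \<omega> = x} \<and> card {k. X k \<omega> = x} \<in> A \<and>
       finite {k. X k \<omega> = x \<and> X (Suc k) \<omega> = Suc x} \<and>
       card {k. X k \<omega> = x \<and> X (Suc k) \<omega> = Suc x} \<in> B}"

definition Cw :: "(nat \<Rightarrow> 'a \<Rightarrow> nat) \<Rightarrow> 'a \<Rightarrow> nat set" where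
  "Cw X \<omega> = {R. \<exists>k. X k \<omega> = R \<and> (\<forall>i<k. X i \<omega> \<le> R) \<and> (\<forall>i>k. R \<le> X i \<omega>)}"

end

theory Submission
  imports Defs
begin

text \<open>
  Let \<open>Q n\<close> be the law of the chain started at \<open>n\<close>. Conditioning on the first step turns every
  probability needed below into a harmonic function of the starting point, hence into a quotient of
  values of the scale function \<open>D(m, n)\<close>; in particular a path at \<open>x + 1\<close> never returns to \<open>x\<close> with
  probability \<open>1 / D(x)\<close>.

  Part (1) follows James, Lyons and Peres. Let \<open>n\<close> be the largest site of the given type in the block
  \<open>(2 \<cdot> 2^j, 4 \<cdot> 2^j]\<close>. Given this, a site \<open>i < n\<close> is visited exactly once with probability at least
  \<open>c / D(i, n) \<ge> c / (n - i)\<close>, because \<open>\<rho> \<le> 1\<close>. So a block that contains a site of the given type is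
  expected to come with at least \<open>c j\<close> sites visited exactly once, while the expected number of the latter
  is at most the sum of \<open>1 / D(i)\<close>; Borel--Cantelli concludes.

  Part (2) is a second moment argument with weights \<open>1 / log x\<close>. Let \<open>E x\<close> be the event that, on
  reaching \<open>x\<close>, the path performs a fixed finite pattern of steps and then leaves \<open>x\<close> upwards for good.
  Since \<open>D(x) = D(x, y) + \<rho>(x+1) \<cdots> \<rho>(y) D(y)\<close>, one has
  \<open>P (E x \<inter> E y) \<le> P (E x) (P (E y) + 2 \<rho>(x+1) \<cdots> \<rho>(y) / D(x, y))\<close>, and the last quotients telescope:
  their sum over \<open>y\<close> is at most \<open>2 log D(x) = O(log x)\<close>. Hence \<open>E x\<close> occurs infinitely often with
  positive probability, and shift-invariant events have probability \<open>0\<close> or \<open>1\<close> as bounded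
  harmonic functions are constant.
\<close>

section \<open>Laws on path space\<close>

abbreviation path_space :: "nat stream measure" where
  "path_space \<equiv> stream_space (count_space UNIV)"

lemma space_path_space [simp]: "space path_space = UNIV"
  by (simp add: space_stream_space)

lemma pred_path_space_iff: "Measurable.pred path_space \<phi> \<longleftrightarrow> {\<omega>. \<phi> \<omega>} \<in> sets path_space"
  by (simp add: pred_def)

text \<open>The coordinates take countably many values, so any relation between two of them is a
  countable union of conditions fixing both values.\<close>

lemma pred_snth2: "Measurable.pred path_space (\<lambda>\<omega>. R (\<omega> !! i) (\<omega> !! j))"
proof -
  have "(\<lambda>\<omega>. R (\<omega> !! i) (\<omega> !! j)) = (\<lambda>\<omega>. \<exists>a b. R a b \<and> \<omega> !! i = a \<and> \<omega> !! j = b)"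
    by auto
  then show ?thesis by simp
qed

text \<open>The Markov property enters only as one-step conditioning, for all starting points at
  once, since the arguments below treat probabilities as functions of the starting point. At
  \<open>n = 0\<close> the truncated \<open>n - 1\<close> is harmless, because its coefficient
  \<open>1 - p 0\<close> is 0.\<close>

locale bd_laws =
  fixes p :: "nat \<Rightarrow> real" and Q :: "nat \<Rightarrow> nat stream measure"
  assumes p_0: "p 0 = 1"
    and p_gt_0: "\<And>k. k \<ge> 1 \<Longrightarrow> 0 < p k"
    and p_lt_1: "\<And>k. k \<ge> 1 \<Longrightarrow> p k < 1"
    and prob_space_Q: "\<And>n. prob_space (Q n)"
    and sets_Q [measurable_cong]: "\<And>n. sets (Q n) = sets path_space"
    and first_step: "\<And>n A. A \<in> sets path_space \<Longrightarrow>
      measure (Q n) A = p n * measure (Q (Suc n)) {\<omega>. n ## \<omega> \<in> A}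
        + (1 - p n) * measure (Q (n - 1)) {\<omega>. n ## \<omega> \<in> A}"
begin

lemma space_Q [simp]: "space (Q n) = UNIV"
  using sets_eq_imp_space_eq[OF sets_Q, of n] by simp

lemma sets_Q_pred: "Measurable.pred path_space \<phi> \<Longrightarrow> {\<omega>. \<phi> \<omega>} \<in> sets (Q n)"
  unfolding sets_Q by (rule pred_path_space_iff[THEN iffD1])

lemma p_pos: "0 < p k"
  using p_0 p_gt_0[of k] by (cases "k = 0") auto

lemma p_le_1: "p k \<le> 1"
  using p_0 p_lt_1[of k] by (cases "k = 0") auto

definition Pr :: "nat \<Rightarrow> (nat stream \<Rightarrow> bool) \<Rightarrow> real" where
  "Pr n \<phi> = measure (Q n) {\<omega>. \<phi> \<omega>}"

lemma Pr_nonneg: "0 \<le> Pr n \<phi>"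
  by (simp add: Pr_def)

lemma Pr_le_1: "Pr n \<phi> \<le> 1"
proof -
  interpret prob_space "Q n" by (rule prob_space_Q)
  show ?thesis by (simp add: Pr_def)
qed

lemma Pr_step:
  assumes "Measurable.pred path_space \<phi>"
  shows "Pr n \<phi> = p n * Pr (Suc n) (\<lambda>\<omega>. \<phi> (n ## \<omega>)) + (1 - p n) * Pr (n - 1) (\<lambda>\<omega>. \<phi> (n ## \<omega>))"
  using first_step[of "{\<omega>. \<phi> \<omega>}" n] sets_Q_pred[OF assms] unfolding Pr_def sets_Q by simp

lemma Pr_mono:
  assumes "Measurable.pred path_space \<psi>" "\<And>\<omega>. \<phi> \<omega> \<Longrightarrow> \<psi> \<omega>"
  shows "Pr n \<phi> \<le> Pr n \<psi>"
proof -
  interpret prob_space "Q n" by (rule prob_space_Q)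
  show ?thesis unfolding Pr_def
    by (intro finite_measure_mono sets_Q_pred assms(1)) (use assms(2) in blast)
qed

text \<open>The start at \<open>n\<close> is encoded in the letter that \<open>first_step\<close>
  prepends: after one step of conditioning both events speak about \<open>n ## \<omega>\<close>,
  whose head is \<open>n\<close>.\<close>

lemma Pr_start:
  assumes [measurable]: "Measurable.pred path_space \<phi>"
  shows "Pr n (\<lambda>\<omega>. shd \<omega> = n \<and> \<phi> \<omega>) = Pr n \<phi>"
proof -
  have [measurable]: "Measurable.pred path_space (\<lambda>\<omega>. shd \<omega> = n \<and> \<phi> \<omega>)" by measurable
  show ?thesis by (simp add: Pr_step[of \<phi> n] Pr_step[of "\<lambda>\<omega>. shd \<omega> = n \<and> \<phi> \<omega>" n])
qed

lemma Pr_start_cong: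
  assumes "Measurable.pred path_space \<phi>" "Measurable.pred path_space \<psi>"
    and "\<And>\<omega>. shd \<omega> = n \<Longrightarrow> \<phi> \<omega> \<longleftrightarrow> \<psi> \<omega>"
  shows "Pr n \<phi> = Pr n \<psi>"
proof -
  have "(\<lambda>\<omega>. shd \<omega> = n \<and> \<phi> \<omega>) = (\<lambda>\<omega>. shd \<omega> = n \<and> \<psi> \<omega>)"
    using assms(3) by blast
  then show ?thesis using Pr_start[OF assms(1), of n] Pr_start[OF assms(2), of n] by simp
qed

lemma Pr_start_mono:
  assumes "Measurable.pred path_space \<phi>" "Measurable.pred path_space \<psi>"
    and "\<And>\<omega>. shd \<omega> = n \<Longrightarrow> \<phi> \<omega> \<Longrightarrow> \<psi> \<omega>"
  shows "Pr n \<phi> \<le> Pr n \<psi>"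
proof -
  have "Pr n (\<lambda>\<omega>. shd \<omega> = n \<and> \<phi> \<omega>) \<le> Pr n \<psi>"
    by (rule Pr_mono[OF assms(2)]) (use assms(3) in blast)
  then show ?thesis by (simp only: Pr_start[OF assms(1)])
qed

lemma Pr_False: "Pr n (\<lambda>_. False) = 0"
  by (simp add: Pr_def)

lemma Pr_True: "Pr n (\<lambda>_. True) = 1"
proof -
  interpret prob_space "Q n" by (rule prob_space_Q)
  show ?thesis using prob_space by (simp add: Pr_def)
qed

lemma Pr_split:
  assumes [measurable]: "Measurable.pred path_space \<phi>" "Measurable.pred path_space \<eta>"
  shows "Pr n \<phi> = Pr n (\<lambda>\<omega>. \<phi> \<omega> \<and> \<eta> \<omega>) + Pr n (\<lambda>\<omega>. \<phi> \<omega> \<and> \<not> \<eta> \<omega>)"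
proof -
  interpret prob_space "Q n" by (rule prob_space_Q)
  have *: "{\<omega>. \<phi> \<omega>} = {\<omega>. \<phi> \<omega> \<and> \<eta> \<omega>} \<union> {\<omega>. \<phi> \<omega> \<and> \<not> \<eta> \<omega>}" by auto
  have "{\<omega>. \<phi> \<omega> \<and> \<eta> \<omega>} \<in> events" by (rule sets_Q_pred) measurable
  moreover have "{\<omega>. \<phi> \<omega> \<and> \<not> \<eta> \<omega>} \<in> events" by (rule sets_Q_pred) measurable
  ultimately have "prob ({\<omega>. \<phi> \<omega> \<and> \<eta> \<omega>} \<union> {\<omega>. \<phi> \<omega> \<and> \<not> \<eta> \<omega>})
      = prob {\<omega>. \<phi> \<omega> \<and> \<eta> \<omega>} + prob {\<omega>. \<phi> \<omega> \<and> \<not> \<eta> \<omega>}"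
    by (rule finite_measure_Union) blast
  then show ?thesis by (simp add: Pr_def flip: *)
qed

lemma Pr_not:
  assumes "Measurable.pred path_space \<phi>"
  shows "Pr n (\<lambda>\<omega>. \<not> \<phi> \<omega>) = 1 - Pr n \<phi>"
  using Pr_split[of "\<lambda>_. True" \<phi> n] assms by (simp add: Pr_True)

lemma AE_iff_Pr_eq_1:
  assumes "Measurable.pred path_space \<phi>"
  shows "(AE \<omega> in Q n. \<phi> \<omega>) \<longleftrightarrow> Pr n \<phi> = 1"
proof -
  interpret prob_space "Q n" by (rule prob_space_Q)
  have "{\<omega>. \<phi> \<omega>} \<in> events" by (rule sets_Q_pred[OF assms])
  then show ?thesis using prob_eq_1[of "{\<omega>. \<phi> \<omega>}"] by (simp add: Pr_def)
qed

lemma AE_iff_Pr_not_eq_0: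
  assumes "Measurable.pred path_space \<phi>"
  shows "(AE \<omega> in Q n. \<phi> \<omega>) \<longleftrightarrow> Pr n (\<lambda>\<omega>. \<not> \<phi> \<omega>) = 0"
  using AE_iff_Pr_eq_1[OF assms] Pr_not[OF assms, of n] by auto

lemma Pr_le_AE:
  assumes "AE \<omega> in Q n. \<phi> \<omega> \<longrightarrow> \<psi> \<omega>" "Measurable.pred path_space \<psi>"
  shows "Pr n \<phi> \<le> Pr n \<psi>"
proof -
  interpret prob_space "Q n" by (rule prob_space_Q)
  show ?thesis unfolding Pr_def
    by (rule finite_measure_mono_AE[OF _ sets_Q_pred[OF assms(2)]]) (use assms(1) in simp)
qed

text \<open>At site 0 the truncated subtraction reads \<open>0 - 1 = 0\<close>, so remaining at 0 is
  not classified as bad.\<close>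

definition bad_step :: "nat \<Rightarrow> nat stream \<Rightarrow> bool" where
  "bad_step k \<omega> \<longleftrightarrow> \<not> (\<omega> !! Suc k = Suc (\<omega> !! k) \<or> \<omega> !! Suc k = \<omega> !! k - 1)"

lemma bad_step_measurable [measurable]: "Measurable.pred path_space (bad_step k)"
  unfolding bad_step_def by (rule pred_snth2)

lemma Pr_bad_step: "Pr n (bad_step k) = 0"
proof (induction k arbitrary: n)
  case 0
  have eq: "bad_step 0 (n ## \<omega>) \<longleftrightarrow> \<not> (shd \<omega> = Suc n \<or> shd \<omega> = n - 1)" for \<omega>
    by (simp add: bad_step_def)
  have "Pr m (\<lambda>\<omega>. \<not> (shd \<omega> = Suc n \<or> shd \<omega> = n - 1)) = Pr m (\<lambda>_. False)"
    if "m = Suc n \<or> m = n - 1" for m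
    by (rule Pr_start_cong, measurable) (use that in simp)
  then show ?case unfolding Pr_step[OF bad_step_measurable, of n 0] eq by (simp add: Pr_False)
next
  case (Suc k)
  have "bad_step (Suc k) (n ## \<omega>) = bad_step k \<omega>" for \<omega> by (simp add: bad_step_def)
  then show ?case unfolding Pr_step[OF bad_step_measurable, of n "Suc k"] by (simp add: Suc)
qed

lemma AE_nearest_neighbour:
  "AE \<omega> in Q n. \<forall>k. \<omega> !! Suc k = Suc (\<omega> !! k) \<or> \<omega> !! Suc k = \<omega> !! k - 1"
proof (subst AE_all_countable, intro allI)
  fix k
  have "Pr n (\<lambda>\<omega>. \<not> (\<omega> !! Suc k = Suc (\<omega> !! k) \<or> \<omega> !! Suc k = \<omega> !! k - 1)) = 0"
    using Pr_bad_step[of n k] by (simp add: bad_step_def[abs_def])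
  then show "AE \<omega> in Q n. \<omega> !! Suc k = Suc (\<omega> !! k) \<or> \<omega> !! Suc k = \<omega> !! k - 1"
    by (subst AE_iff_Pr_not_eq_0) (rule pred_snth2)
qed

lemma AE_start: "AE \<omega> in Q n. shd \<omega> = n"
  using Pr_start[of "\<lambda>_. True" n] by (subst AE_iff_Pr_eq_1) (auto simp: Pr_True)

text \<open>A path with steps of size at most one cannot get below \<open>n\<close> without visiting
  \<open>n\<close>.\<close>

lemma AE_stays_above:
  "AE \<omega> in Q (Suc n). alw (\<lambda>\<omega>. shd \<omega> \<noteq> n) \<omega> \<longrightarrow> alw (HLD {n..}) \<omega>"
  using AE_start[of "Suc n"] AE_nearest_neighbour[of "Suc n"]
proof eventually_elim
  fix \<omega> :: "nat stream"
  assume start: "shd \<omega> = Suc n"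
    and nn: "\<forall>k. \<omega> !! Suc k = Suc (\<omega> !! k) \<or> \<omega> !! Suc k = \<omega> !! k - 1"
  show "alw (\<lambda>\<omega>. shd \<omega> \<noteq> n) \<omega> \<longrightarrow> alw (HLD {n..}) \<omega>"
  proof
    assume "alw (\<lambda>\<omega>. shd \<omega> \<noteq> n) \<omega>"
    then have ne: "\<omega> !! k \<noteq> n" for k by (simp add: alw_iff_sdrop)
    have "n < \<omega> !! k" for k
    proof (induction k)
      case 0 then show ?case using start by simp
    next
      case (Suc k)
      have "\<omega> !! Suc k = Suc (\<omega> !! k) \<or> \<omega> !! Suc k = \<omega> !! k - 1" using nn by blast
      then show ?case using Suc ne[of "Suc k"] by linarith
    qed
    then show "alw (HLD {n..}) \<omega>" by (simp add: alw_iff_sdrop HLD_iff less_imp_le)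
  qed
qed

end

section \<open>Harmonic functions and escape probabilities\<close>

definition rho_prod :: "(nat \<Rightarrow> real) \<Rightarrow> nat \<Rightarrow> nat \<Rightarrow> real" where
  "rho_prod p m n = (\<Prod>i\<in>{m+1..n}. rho p i)"

text \<open>This is \<open>D(m, n)\<close> in a form without case distinction: the cases
  \<open>n = m\<close> and \<open>n = m + 1\<close> are the empty sum and the single summand
  \<open>rho_prod p m m = 1\<close>.\<close>

definition scale :: "(nat \<Rightarrow> real) \<Rightarrow> nat \<Rightarrow> nat \<Rightarrow> real" where
  "scale p m n = (\<Sum>j\<in>{m..<n}. rho_prod p m j)"

lemma rho_prod_self [simp]: "rho_prod p m m = 1"
  by (simp add: rho_prod_def)

lemma rho_prod_Suc: "m \<le> n \<Longrightarrow> rho_prod p m (Suc n) = rho_prod p m n * rho p (Suc n)"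
  by (simp add: rho_prod_def)

lemma scale_self [simp]: "scale p m m = 0"
  by (simp add: scale_def)

lemma scale_Suc: "m \<le> n \<Longrightarrow> scale p m (Suc n) = scale p m n + rho_prod p m n"
  by (simp add: scale_def)

lemma scale_Suc_self [simp]: "scale p m (Suc m) = 1"
  by (simp add: scale_Suc)

lemma Dmn_eq_scale:
  assumes "m \<le> n"
  shows "Dmn p m n = scale p m n"
proof (cases "n = m")
  case False
  obtain d where n: "n = Suc (m + d)" using assms False by (metis le_neq_implies_less less_imp_Suc_add)
  have "scale p m (Suc (m + d)) = 1 + (\<Sum>j\<in>{1..d}. rho_prod p m (m + j))" for d
  proof (induction d)
    case (Suc d)
    then show ?case using scale_Suc[of m "m + Suc d" p] by simp
  qed simp
  then show ?thesis by (simp add: Dmn_def n rho_prod_def)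
qed (simp add: Dmn_def)

context bd_laws
begin

lemma rho_nonneg: "0 \<le> rho p k"
  using p_pos[of k] p_le_1[of k] by (simp add: rho_def)

lemma rho_prod_nonneg: "0 \<le> rho_prod p m n"
  by (simp add: rho_prod_def prod_nonneg rho_nonneg)

lemma scale_nonneg: "0 \<le> scale p m n"
  by (simp add: scale_def sum_nonneg rho_prod_nonneg)

lemma scale_mono: "m \<le> n \<Longrightarrow> scale p a m \<le> scale p a n"
  unfolding scale_def by (intro sum_mono2) (auto simp: rho_prod_nonneg)

lemma scale_ge_1: "m < n \<Longrightarrow> 1 \<le> scale p m n"
  using scale_mono[of "Suc m" n m] by simp

text \<open>Harmonicity balances the upward increment, weighted by \<open>p m\<close>, against the
  downward one, weighted by \<open>1 - p m\<close>; dividing by \<open>p m\<close> leaves the ratio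
  \<open>rho p m\<close>.\<close>

lemma harmonic_increment:
  assumes "f m = p m * f (Suc m) + (1 - p m) * f (m - 1)"
  shows "f (Suc m) - f m = rho p m * (f m - f (m - 1))"
proof -
  have "p m * (f (Suc m) - f m) = (1 - p m) * (f m - f (m - 1))"
    using assms by (simp add: algebra_simps)
  then have "f (Suc m) - f m = (1 - p m) * (f m - f (m - 1)) / p m"
    using p_pos[of m] by (metis less_irrefl nonzero_mult_div_cancel_left)
  then show ?thesis by (simp add: rho_def)
qed

text \<open>The increments of a function vanishing at \<open>a\<close> are \<open>f (Suc a)\<close>
  times the products of the ratios \<open>rho\<close>; adding them up produces the scale
  function.\<close>

lemma harmonic_eq_scale:
  assumes "f a = 0"
    and harm: "\<And>m. a < m \<Longrightarrow> m < b \<Longrightarrow> f m = p m * f (Suc m) + (1 - p m) * f (m - 1)"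
    and "a \<le> m" "m \<le> b"
  shows "f m = f (Suc a) * scale p a m"
proof -
  have inc: "f (Suc m) - f m = f (Suc a) * rho_prod p a m" if "a \<le> m" "m < b" for m
    using that
  proof (induction m rule: dec_induct)
    case base then show ?case using \<open>f a = 0\<close> by simp
  next
    case (step n)
    have "f (Suc (Suc n)) - f (Suc n) = rho p (Suc n) * (f (Suc n) - f n)"
      using harmonic_increment[of f "Suc n", OF harm[of "Suc n"]] step by simp
    also have "f (Suc n) - f n = f (Suc a) * rho_prod p a n" using step by simp
    finally show ?case by (simp only: rho_prod_Suc[OF step.hyps(1)] mult_ac)
  qed
  show ?thesis using assms(3,4)
  proof (induction m rule: dec_induct)
    case (step n)
    then have "f (Suc n) = f n + f (Suc a) * rho_prod p a n" "f n = f (Suc a) * scale p a n"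
      using inc[of n] by simp_all
    then show ?case by (simp only: scale_Suc[OF step.hyps(1)] distrib_left)
  qed (use \<open>f a = 0\<close> in simp)
qed

text \<open>The scale function is itself harmonic above its base point, which makes it the
  comparison function in \<open>escape_ge\<close>.\<close>

lemma scale_harmonic:
  assumes "a < m"
  shows "scale p a m = p m * scale p a (Suc m) + (1 - p m) * scale p a (m - 1)"
proof -
  obtain n where m: "m = Suc n" "a \<le> n" using assms by (cases m) auto
  have "p m * rho p m = 1 - p m" using p_pos[of m] by (simp add: rho_def)
  then have *: "rho_prod p a n = p m * rho_prod p a n + p m * rho p m * rho_prod p a n"
    by (metis add.commute add_diff_cancel_left' diff_add_cancel distrib_right mult_1)
  then show ?thesis using m by (simp add: scale_Suc rho_prod_Suc algebra_simps)
qed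

text \<open>At 0 the increment formula has the right-hand side \<open>f 0 - f (0 - 1) = 0\<close>,
  so the first increment vanishes, and every later one is a multiple of its predecessor.\<close>

lemma harmonic_const:
  assumes harm: "\<And>m. m < b \<Longrightarrow> f m = p m * f (Suc m) + (1 - p m) * f (m - 1)"
    and "m \<le> b"
  shows "f m = f b"
proof -
  have eq: "f (Suc m) = f m" if "m < b" for m
    using that
  proof (induction m)
    case 0 then show ?case using harmonic_increment[of f 0, OF harm[OF 0]] by simp
  next
    case (Suc m) then show ?case using harmonic_increment[of f "Suc m", OF harm[OF Suc.prems]] by simp
  qed
  show ?thesis using \<open>m \<le> b\<close> by (induction m rule: inc_induct) (simp_all add: eq)
qed

text \<open>An event unaffected by steps taken below \<open>b\<close> has a probability that is
  harmonic in the starting point below \<open>b\<close>, hence constant there. This takes the place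
  of the strong Markov property at the first visit to \<open>b\<close>.\<close>

lemma Pr_eq_of_prefix_invariant:
  assumes "Measurable.pred path_space \<phi>"
    and inv: "\<And>m \<omega>. m < b \<Longrightarrow> \<phi> (m ## \<omega>) \<longleftrightarrow> \<phi> \<omega>"
    and "m \<le> b"
  shows "Pr m \<phi> = Pr b \<phi>"
proof (rule harmonic_const[of b "\<lambda>m. Pr m \<phi>", OF _ \<open>m \<le> b\<close>])
  fix m assume "m < b"
  then show "Pr m \<phi> = p m * Pr (Suc m) \<phi> + (1 - p m) * Pr (m - 1) \<phi>"
    unfolding Pr_step[OF assms(1), of m] by (simp add: inv)
qed

definition first_hit :: "nat \<Rightarrow> (nat stream \<Rightarrow> bool) \<Rightarrow> nat stream \<Rightarrow> bool" where
  "first_hit b \<psi> = ((\<lambda>\<omega>. shd \<omega> \<noteq> b) suntil (\<lambda>\<omega>. shd \<omega> = b \<and> \<psi> \<omega>))"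

lemma first_hit_measurable [measurable]:
  "Measurable.pred path_space \<psi> \<Longrightarrow> Measurable.pred path_space (first_hit b \<psi>)"
  unfolding first_hit_def by measurable

lemma first_hit_SCons: "first_hit b \<psi> (m ## \<omega>) \<longleftrightarrow> (if m = b then \<psi> (m ## \<omega>) else first_hit b \<psi> \<omega>)"
  by (auto simp: first_hit_def suntil_Stream)

text \<open>The value is \<open>1 / D(x)\<close>, read as 0 if \<open>D(x)\<close> is infinite;
  \<open>escape_scale_le_1\<close> and \<open>escape_ge\<close> supply the two inequalities.\<close>

definition escape :: "nat \<Rightarrow> real" where
  "escape x = Pr (Suc x) (alw (\<lambda>\<omega>. shd \<omega> \<noteq> x))"

lemma escape_nonneg: "0 \<le> escape x"
  by (simp add: escape_def Pr_nonneg)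

text \<open>The probability of avoiding \<open>x\<close>, as a function of the starting point,
  vanishes at \<open>x\<close> and is harmonic above it. So its value at \<open>n\<close> is the
  left-hand side, and a probability is at most 1.\<close>

lemma escape_scale_le_1:
  assumes "x \<le> n" shows "escape x * scale p x n \<le> 1"
proof -
  let ?f = "\<lambda>m. Pr m (alw (\<lambda>\<omega>. shd \<omega> \<noteq> x))"
  have [measurable]: "Measurable.pred path_space (alw (\<lambda>\<omega>. shd \<omega> \<noteq> x))" by measurable
  have alw: "alw (\<lambda>\<omega>. shd \<omega> \<noteq> x) (m ## \<omega>) \<longleftrightarrow> m \<noteq> x \<and> alw (\<lambda>\<omega>. shd \<omega> \<noteq> x) \<omega>" for m \<omega>
    by (subst alw.simps) simp
  have step: "?f m = p m * Pr (Suc m) (\<lambda>\<omega>. m \<noteq> x \<and> alw (\<lambda>\<omega>. shd \<omega> \<noteq> x) \<omega>)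
      + (1 - p m) * Pr (m - 1) (\<lambda>\<omega>. m \<noteq> x \<and> alw (\<lambda>\<omega>. shd \<omega> \<noteq> x) \<omega>)" for m
    by (subst Pr_step, measurable) (simp only: alw)
  have "?f x = 0" using step[of x] by (simp add: Pr_False)
  moreover have "?f m = p m * ?f (Suc m) + (1 - p m) * ?f (m - 1)" if "x < m" "m < n" for m
    using step[of m] that by simp
  ultimately have "?f n = escape x * scale p x n"
    unfolding escape_def by (intro harmonic_eq_scale[where b = n]) (use assms in auto)
  then show ?thesis using Pr_le_1[of n] by metis
qed

text \<open>The function \<open>1 - scale p x m / d\<close> is harmonic above \<open>x\<close>,
  nonnegative, and equal to 1 at \<open>x\<close>. By induction on \<open>t\<close> it therefore
  dominates the probability of hitting \<open>x\<close> within \<open>t\<close> steps; then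
  \<open>t\<close> tends to infinity.\<close>

lemma escape_ge:
  assumes bound: "\<And>n. x \<le> n \<Longrightarrow> scale p x n \<le> d"
  shows "1 / d \<le> escape x"
proof -
  have d: "1 \<le> d" using bound[of "Suc x"] by simp
  let ?hit = "\<lambda>t \<omega>. \<exists>k\<le>t. \<omega> !! k = x"
  have [measurable]: "Measurable.pred path_space (?hit t)" for t by measurable
  have hit: "?hit (Suc t) (m ## \<omega>) \<longleftrightarrow> m = x \<or> ?hit t \<omega>" for t m \<omega>
  proof
    assume "?hit (Suc t) (m ## \<omega>)"
    then obtain k where "k \<le> Suc t" "(m ## \<omega>) !! k = x" by blast
    then show "m = x \<or> ?hit t \<omega>" by (cases k) auto
  next
    assume "m = x \<or> ?hit t \<omega>"
    then show "?hit (Suc t) (m ## \<omega>)"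
      by (metis Suc_le_mono le0 snth.simps(1) snth_Stream stream.sel(1))
  qed
  have le: "Pr m (?hit t) \<le> 1 - scale p x m / d" if "x \<le> m" for t m
    using that
  proof (induction t arbitrary: m)
    case 0
    show ?case
    proof (cases "m = x")
      case True then show ?thesis by (simp add: Pr_le_1)
    next
      case False
      have "Pr m (?hit 0) = Pr m (\<lambda>_. False)"
        by (rule Pr_start_cong, measurable) (use False in simp)
      then show ?thesis using bound[OF 0] d by (simp add: Pr_False divide_le_eq)
    qed
  next
    case (Suc t)
    show ?case
    proof (cases "m = x")
      case True then show ?thesis by (simp add: Pr_le_1)
    next
      case False
      then have "x < m" using Suc by simp
      have "Pr m (?hit (Suc t)) = p m * Pr (Suc m) (?hit t) + (1 - p m) * Pr (m - 1) (?hit t)"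
        unfolding Pr_step[of "?hit (Suc t)" m, OF \<open>Measurable.pred path_space (?hit (Suc t))\<close>] hit
        using False by simp
      also have "\<dots> \<le> p m * (1 - scale p x (Suc m) / d) + (1 - p m) * (1 - scale p x (m - 1) / d)"
        using Suc.IH[of "Suc m"] Suc.IH[of "m - 1"] \<open>x < m\<close> p_pos[of m] p_le_1[of m]
        by (intro add_mono mult_left_mono) auto
      also have "\<dots> = 1 - (p m * scale p x (Suc m) + (1 - p m) * scale p x (m - 1)) / d"
        using d by (simp add: field_simps)
      also have "\<dots> = 1 - scale p x m / d"
        using scale_harmonic[OF \<open>x < m\<close>] by simp
      finally show ?thesis .
    qed
  qed
  interpret prob_space "Q (Suc x)" by (rule prob_space_Q)
  have "(\<lambda>t. measure (Q (Suc x)) {\<omega>. ?hit t \<omega>}) \<longlonglongrightarrow> measure (Q (Suc x)) (\<Union>t. {\<omega>. ?hit t \<omega>})"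
  proof (rule finite_Lim_measure_incseq)
    show "range (\<lambda>t. {\<omega>. ?hit t \<omega>}) \<subseteq> events"
      by (intro image_subsetI sets_Q_pred) measurable
    show "incseq (\<lambda>t. {\<omega>. ?hit t \<omega>})" unfolding incseq_def using order_trans by blast
  qed
  moreover have "(\<Union>t. {\<omega>. ?hit t \<omega>}) = {\<omega>. ev (\<lambda>\<omega>. shd \<omega> = x) \<omega>}"
    unfolding ev_iff_sdrop sdrop_simps by blast
  ultimately have "(\<lambda>t. Pr (Suc x) (?hit t)) \<longlonglongrightarrow> Pr (Suc x) (ev (\<lambda>\<omega>. shd \<omega> = x))"
    by (simp add: Pr_def)
  then have "Pr (Suc x) (ev (\<lambda>\<omega>. shd \<omega> = x)) \<le> 1 - scale p x (Suc x) / d"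
    by (rule LIMSEQ_le_const2) (use le[of "Suc x"] in auto)
  moreover have "escape x = 1 - Pr (Suc x) (ev (\<lambda>\<omega>. shd \<omega> = x))"
    unfolding escape_def by (subst Pr_not[symmetric], measurable) (simp add: not_ev_iff)
  ultimately show ?thesis by simp
qed

end

section \<open>Zero-one law and the laws of a given chain\<close>

context bd_laws
begin

text \<open>As \<open>Pr n E\<close> does not depend on \<open>n\<close>, peeling off letters shows
  that \<open>E\<close> is independent of every cylinder. Hence conditioning on \<open>E\<close>
  leaves the law of the path unchanged, and under the conditioned law \<open>E\<close> has
  probability 1.\<close>

theorem shift_invariant_zero_one:
  assumes [measurable]: "Measurable.pred path_space E"
    and inv: "\<And>n \<omega>. E (n ## \<omega>) \<longleftrightarrow> E \<omega>"
    and pos: "Pr 0 E \<noteq> 0"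
  shows "Pr 0 E = 1"
proof -
  have const: "Pr n E = Pr 0 E" for n
    using Pr_eq_of_prefix_invariant[OF assms(1) inv, of 0 n] by simp
  have indep: "Pr n (\<lambda>\<omega>. \<omega> \<in> sstart UNIV xs \<and> E \<omega>) = Pr n (\<lambda>\<omega>. \<omega> \<in> sstart UNIV xs) * Pr 0 E" for n xs
  proof (induction xs arbitrary: n)
    case Nil
    show ?case using const[of n] by (simp add: Pr_True)
  next
    case (Cons x xs)
    have step1: "Pr n (\<lambda>\<omega>. \<omega> \<in> sstart UNIV (x # xs) \<and> E \<omega>)
        = p n * Pr (Suc n) (\<lambda>\<omega>. n ## \<omega> \<in> sstart UNIV (x # xs) \<and> E (n ## \<omega>))
          + (1 - p n) * Pr (n - 1) (\<lambda>\<omega>. n ## \<omega> \<in> sstart UNIV (x # xs) \<and> E (n ## \<omega>))"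
      by (rule Pr_step) measurable
    have step2: "Pr n (\<lambda>\<omega>. \<omega> \<in> sstart UNIV (x # xs))
        = p n * Pr (Suc n) (\<lambda>\<omega>. n ## \<omega> \<in> sstart UNIV (x # xs))
          + (1 - p n) * Pr (n - 1) (\<lambda>\<omega>. n ## \<omega> \<in> sstart UNIV (x # xs))"
      by (rule Pr_step) measurable
    show ?case
      unfolding step1 step2 by (cases "n = x") (simp_all add: Cons inv Pr_False algebra_simps)
  qed
  interpret prob_space "Q 0" by (rule prob_space_Q)
  let ?A = "{\<omega>. E \<omega>}"
  have A: "?A \<in> events" by (rule sets_Q_pred) measurable
  have A_pos: "emeasure (Q 0) ?A \<noteq> 0"
    using pos unfolding Pr_def measure_def by auto
  have A_fin: "emeasure (Q 0) ?A \<noteq> \<infinity>" by (simp add: emeasure_eq_measure)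
  have "uniform_measure (Q 0) ?A = Q 0"
  proof (rule stream_space_eq_sstart[where S = UNIV])
    show "prob_space (uniform_measure (Q 0) ?A)"
      by (rule prob_space_uniform_measure) (use A_pos A_fin in auto)
    fix xs :: "nat list"
    have S: "sstart UNIV xs \<in> events" by (simp add: sets_Q)
    have "?A \<inter> sstart UNIV xs = {\<omega>. \<omega> \<in> sstart UNIV xs \<and> E \<omega>}" by auto
    then have "measure (Q 0) (?A \<inter> sstart UNIV xs) = measure (Q 0) (sstart UNIV xs) * measure (Q 0) ?A"
      using indep[of 0 xs] by (simp add: Pr_def)
    then have "emeasure (Q 0) (?A \<inter> sstart UNIV xs) = emeasure (Q 0) (sstart UNIV xs) * emeasure (Q 0) ?A"
      by (simp add: emeasure_eq_measure ennreal_mult)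
    then show "emeasure (uniform_measure (Q 0) ?A) (sstart UNIV xs) = emeasure (Q 0) (sstart UNIV xs)"
      using A_pos A_fin by (subst emeasure_uniform_measure[OF A S]) (simp add: ennreal_mult_divide_eq)
  qed (simp_all add: sets_Q prob_space_axioms)
  moreover have "emeasure (uniform_measure (Q 0) ?A) ?A = 1"
    unfolding emeasure_uniform_measure[OF A A] Int_absorb
    by (rule ennreal_divide_self[OF A_pos]) (simp add: emeasure_eq_measure)
  ultimately show ?thesis by (simp add: Pr_def measure_def)
qed

end

section \<open>Construction of the laws \<open>Q n\<close> from a given chain\<close>

locale bd_process =
  fixes M :: "'a measure" and p :: "nat \<Rightarrow> real" and X :: "nat \<Rightarrow> 'a \<Rightarrow> nat"
  assumes chain: "bd_chain M p X"
    and p_0: "p 0 = 1"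
    and p_gt_0: "\<And>k. k \<ge> 1 \<Longrightarrow> 0 < p k"
    and p_lt_1: "\<And>k. k \<ge> 1 \<Longrightarrow> p k < 1"

sublocale bd_process \<subseteq> prob_space M
  using chain by (simp add: bd_chain_def)

context bd_process
begin

lemma X_measurable [measurable]: "X k \<in> measurable M (count_space UNIV)"
  using chain by (simp add: bd_chain_def)

lemma X_0: "\<omega> \<in> space M \<Longrightarrow> X 0 \<omega> = 0"
  using chain by (simp add: bd_chain_def)

definition cyl :: "nat \<Rightarrow> (nat \<Rightarrow> nat) \<Rightarrow> 'a set" where
  "cyl k h = {\<omega>\<in>space M. \<forall>i\<le>k. X i \<omega> = h i}"

definition future :: "nat \<Rightarrow> 'a \<Rightarrow> nat stream" where
  "future k \<omega> = to_stream (\<lambda>j. X (k + j) \<omega>)"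

definition trans :: "nat \<Rightarrow> nat \<Rightarrow> real" where
  "trans n m = (if m = Suc n then p n else if 0 < n \<and> m = n - 1 then 1 - p n else 0)"

primrec weight :: "nat \<Rightarrow> nat list \<Rightarrow> real" where
  "weight n [] = 1"
| "weight n (x # xs) = trans n x * weight x xs"

definition law :: "nat \<Rightarrow> (nat \<Rightarrow> nat) \<Rightarrow> nat stream measure" where
  "law k h = distr (uniform_measure M (cyl k h)) path_space (future k)"

text \<open>The conditional law of the path from time \<open>n\<close> on, given the straight climb
  through 0, 1, ..., \<open>n\<close>. This climb has positive probability, so each starting point
  receives a law from the given chain alone.\<close>

definition Q :: "nat \<Rightarrow> nat stream measure" where
  "Q n = law n (\<lambda>i. i)"

lemma cyl_sets [measurable]: "cyl k h \<in> events"
  unfolding cyl_def by measurable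

lemma future_measurable [measurable]: "future k \<in> measurable M path_space"
  by (rule measurable_stream_space2) (simp add: future_def[abs_def] to_stream_def)

lemma future_unfold: "future k \<omega> = X k \<omega> ## future (Suc k) \<omega>"
proof -
  have "(\<lambda>j. X (k + j) \<omega>) = case_nat (X k \<omega>) (\<lambda>j. X (Suc k + j) \<omega>)"
    by (auto split: nat.split)
  then show ?thesis unfolding future_def by (simp only: to_stream_nat_case)
qed

lemma cyl_Suc: "cyl (Suc k) (h(Suc k := x)) = {\<omega>\<in>cyl k h. X (Suc k) \<omega> = x}"
  by (auto simp: cyl_def le_Suc_eq)

text \<open>The definition of the chain prescribes only the upward and downward probabilities. They
  add up to the mass of the cylinder, so any other next value has probability 0.\<close>

lemma prob_cyl_Suc: "prob (cyl (Suc k) (h(Suc k := x))) = trans (h k) x * prob (cyl k h)"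
proof -
  have up: "prob (cyl (Suc k) (h(Suc k := Suc (h k)))) = p (h k) * prob (cyl k h)"
  proof -
    have "cyl (Suc k) (h(Suc k := Suc (h k)))
        = {\<omega>\<in>space M. (\<forall>i\<le>k. X i \<omega> = h i) \<and> X (Suc k) \<omega> = Suc (h k)}"
      by (auto simp: cyl_Suc cyl_def)
    then show ?thesis using chain unfolding bd_chain_def cyl_def by simp
  qed
  have down: "prob (cyl (Suc k) (h(Suc k := h k - 1))) = (1 - p (h k)) * prob (cyl k h)" if "0 < h k"
  proof -
    have "cyl (Suc k) (h(Suc k := h k - 1))
        = {\<omega>\<in>space M. (\<forall>i\<le>k. X i \<omega> = h i) \<and> X (Suc k) \<omega> = h k - 1}"
      by (auto simp: cyl_Suc cyl_def)
    then show ?thesis using chain that unfolding bd_chain_def cyl_def by simp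
  qed
  consider "x = Suc (h k)" | "0 < h k" "x = h k - 1" | "x \<noteq> Suc (h k)" "0 < h k \<longrightarrow> x \<noteq> h k - 1"
    by fastforce
  then show ?thesis
  proof cases
    case 3
    let ?U = "cyl (Suc k) (h(Suc k := Suc (h k)))" and ?D = "cyl (Suc k) (h(Suc k := h k - 1))"
      and ?Z = "cyl (Suc k) (h(Suc k := x))"
    have "prob ?Z = 0"
    proof (cases "h k = 0")
      case True
      have "prob (?U \<union> ?Z) = prob ?U + prob ?Z"
        by (rule finite_measure_Union) (use 3 in \<open>auto simp: cyl_Suc\<close>)
      moreover have "prob (?U \<union> ?Z) \<le> prob (cyl k h)"
        by (rule finite_measure_mono) (auto simp: cyl_Suc)
      ultimately show ?thesis using up True p_0 by (simp add: measure_le_0_iff)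
    next
      case False
      have "prob (?U \<union> ?D \<union> ?Z) = prob (?U \<union> ?D) + prob ?Z"
        by (rule finite_measure_Union) (use 3 False in \<open>auto simp: cyl_Suc\<close>)
      also have "prob (?U \<union> ?D) = prob ?U + prob ?D"
        by (rule finite_measure_Union) (use 3 in \<open>auto simp: cyl_Suc\<close>)
      also have "prob ?U + prob ?D = prob (cyl k h)"
        using False unfolding up down[OF False[unfolded neq0_conv]] by (simp add: left_diff_distrib)
      finally have "prob (?U \<union> ?D \<union> ?Z) = prob (cyl k h) + prob ?Z" .
      moreover have "prob (?U \<union> ?D \<union> ?Z) \<le> prob (cyl k h)"
        by (rule finite_measure_mono) (auto simp: cyl_Suc)
      ultimately show ?thesis by (simp add: measure_le_0_iff)
    qed
    then show ?thesis using 3 by (auto simp: trans_def)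
  qed (use up down in \<open>auto simp: trans_def\<close>)
qed

text \<open>Induction on the word: its first letter is moved from the future into the cylinder, at
  the cost of one transition factor.\<close>

lemma prob_cyl_prefix:
  "prob {\<omega>\<in>cyl k h. future (Suc k) \<omega> \<in> sstart UNIV xs} = weight (h k) xs * prob (cyl k h)"
proof (induction xs arbitrary: k h)
  case (Cons x xs)
  have "{\<omega>\<in>cyl k h. future (Suc k) \<omega> \<in> sstart UNIV (x # xs)}
      = {\<omega>\<in>cyl (Suc k) (h(Suc k := x)). future (Suc (Suc k)) \<omega> \<in> sstart UNIV xs}"
    by (auto simp: cyl_Suc future_unfold[of "Suc k"])
  then have "prob {\<omega>\<in>cyl k h. future (Suc k) \<omega> \<in> sstart UNIV (x # xs)}
      = weight x xs * prob (cyl (Suc k) (h(Suc k := x)))"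
    by (simp only: Cons fun_upd_same)
  then show ?case by (simp only: prob_cyl_Suc weight.simps mult_ac)
qed (simp add: cyl_def)

lemma sets_law [measurable_cong]: "sets (law k h) = sets path_space"
  by (simp add: law_def)

lemma space_law [simp]: "space (law k h) = UNIV"
  by (simp add: law_def space_stream_space)

lemma prob_space_law:
  assumes "prob (cyl k h) \<noteq> 0"
  shows "prob_space (law k h)"
  unfolding law_def
proof (rule prob_space.prob_space_distr)
  show "prob_space (uniform_measure M (cyl k h))"
    by (rule prob_space_uniform_measure) (use assms in \<open>auto simp: emeasure_eq_measure\<close>)
  show "future k \<in> measurable (uniform_measure M (cyl k h)) path_space" by measurable
qed

lemma prob_cyl_law:
  assumes pos: "prob (cyl k h) \<noteq> 0" and A: "A \<in> sets path_space"
  shows "measure (law k h) A = prob {\<omega>\<in>cyl k h. future k \<omega> \<in> A} / prob (cyl k h)"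
proof -
  have m: "future k \<in> measurable (uniform_measure M (cyl k h)) path_space" by measurable
  have "measure (law k h) A = measure (uniform_measure M (cyl k h)) (future k -` A \<inter> space M)"
    unfolding law_def by (subst measure_distr[OF m A]) simp
  also have "\<dots> = prob (cyl k h \<inter> (future k -` A \<inter> space M)) / prob (cyl k h)"
    by (subst measure_uniform_measure)
       (use pos measurable_sets[OF future_measurable A] in \<open>auto simp: emeasure_eq_measure\<close>)
  also have "cyl k h \<inter> (future k -` A \<inter> space M) = {\<omega>\<in>cyl k h. future k \<omega> \<in> A}"
    by (auto simp: cyl_def)
  finally show ?thesis .
qed

lemma measure_law_sstart:
  assumes pos: "prob (cyl k h) \<noteq> 0"
  shows "measure (law k h) (sstart UNIV (x # xs)) = (if x = h k then weight x xs else 0)"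
proof -
  have "{\<omega>\<in>cyl k h. future k \<omega> \<in> sstart UNIV (x # xs)}
      = (if x = h k then {\<omega>\<in>cyl k h. future (Suc k) \<omega> \<in> sstart UNIV xs} else {})"
    by (auto simp: future_unfold[of k] cyl_def)
  then show ?thesis using pos by (simp add: prob_cyl_law[OF pos] prob_cyl_prefix)
qed

text \<open>The Markov property: the weights of words depend on the history only through its last
  site, and a law on path space is determined by its values on words.\<close>

lemma law_eqI:
  assumes pos: "prob (cyl k h) \<noteq> 0" and pos': "prob (cyl k' h') \<noteq> 0" and "h k = h' k'"
  shows "law k h = law k' h'"
proof (rule stream_space_eq_sstart[where S = UNIV])
  fix xs :: "nat list" assume "xs \<noteq> []"
  then obtain y ys where xs: "xs = y # ys" by (cases xs) auto
  interpret L: prob_space "law k h" by (rule prob_space_law[OF pos])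
  interpret L': prob_space "law k' h'" by (rule prob_space_law[OF pos'])
  show "emeasure (law k h) (sstart UNIV xs) = emeasure (law k' h') (sstart UNIV xs)"
    unfolding L.emeasure_eq_measure L'.emeasure_eq_measure xs
    by (simp only: measure_law_sstart[OF pos] measure_law_sstart[OF pos'] \<open>h k = h' k'\<close>)
qed (simp_all add: prob_space_law pos pos' sets_law)

lemma prob_cyl_id: "0 < prob (cyl n (\<lambda>i. i))"
proof (induction n)
  case 0
  have "cyl 0 (\<lambda>i. i) = space M" by (auto simp: cyl_def X_0)
  then show ?case by (simp add: prob_space)
next
  case (Suc n)
  have *: "(\<lambda>i. i)(Suc n := Suc n) = (\<lambda>i. i)" by auto
  have "prob (cyl (Suc n) (\<lambda>i. i)) = trans n (Suc n) * prob (cyl n (\<lambda>i. i))"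
    using prob_cyl_Suc[of n "\<lambda>i. i" "Suc n"] by (simp only: *)
  moreover have "0 < p n" using p_0 p_gt_0[of n] by (cases "n = 0") auto
  ultimately show ?case using Suc by (simp add: trans_def)
qed

lemma prob_cyl_future:
  assumes "A \<in> sets path_space"
  shows "prob {\<omega>\<in>cyl k h. future k \<omega> \<in> A} = measure (Q (h k)) A * prob (cyl k h)"
proof (cases "prob (cyl k h) = 0")
  case True
  have "prob {\<omega>\<in>cyl k h. future k \<omega> \<in> A} \<le> prob (cyl k h)"
    by (rule finite_measure_mono) auto
  then show ?thesis using True by (simp add: measure_le_0_iff)
next
  case False
  have "Q (h k) = law k h"
    unfolding Q_def by (rule law_eqI) (use prob_cyl_id[of "h k"] False in auto)
  then show ?thesis using prob_cyl_law[OF False assms] False by simp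
qed

text \<open>Split the climb to \<open>n\<close> according to the value at time \<open>n + 1\<close>.
  The part where this value is not a neighbour of \<open>n\<close> is null, and on the other parts
  \<open>prob_cyl_future\<close> applies one step later.\<close>

lemma Q_first_step:
  assumes A: "A \<in> sets path_space"
  shows "measure (Q n) A = p n * measure (Q (Suc n)) {\<omega>. n ## \<omega> \<in> A}
        + (1 - p n) * measure (Q (n - 1)) {\<omega>. n ## \<omega> \<in> A}"
proof -
  let ?h = "\<lambda>i::nat. i"
  define B where "B = {\<omega>. n ## \<omega> \<in> A}"
  have "(\<lambda>\<omega>. n ## \<omega>) \<in> measurable path_space path_space" by measurable
  from measurable_sets[OF this A] have B: "B \<in> sets path_space" by (simp add: B_def vimage_def)
  let ?C = "\<lambda>x. cyl (Suc n) (?h(Suc n := x))"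
  let ?E = "\<lambda>x. {\<omega>\<in>?C x. future (Suc n) \<omega> \<in> B}"
  let ?F = "{\<omega>\<in>cyl n ?h. future n \<omega> \<in> A}"
  have meas: "{\<omega>\<in>cyl k h. future k \<omega> \<in> A'} \<in> events" if "A' \<in> sets path_space" for k h A'
  proof -
    have "{\<omega>\<in>cyl k h. future k \<omega> \<in> A'} = cyl k h \<inter> (future k -` A' \<inter> space M)" by (auto simp: cyl_def)
    then show ?thesis using measurable_sets[OF future_measurable that] by auto
  qed
  have E: "prob (?E x) = measure (Q x) B * (trans n x * prob (cyl n ?h))" for x
    by (simp only: prob_cyl_future[OF B] prob_cyl_Suc fun_upd_same)
  have E_sub: "?E x \<subseteq> ?F" for x by (auto simp: cyl_Suc future_unfold[of n] B_def cyl_def)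
  have F_sub: "\<omega> \<in> ?E x" if "\<omega> \<in> ?F" "\<omega> \<in> ?C x" for \<omega> x
    using that by (auto simp: cyl_Suc future_unfold[of n] B_def cyl_def)
  have "prob ?F = (p n * measure (Q (Suc n)) B + (1 - p n) * measure (Q (n - 1)) B) * prob (cyl n ?h)"
  proof (cases "n = 0")
    case True
    \<comment> \<open>Because \<open>p 0 = 1\<close>, the upward cylinder alone carries the full
      mass, so \<open>?F\<close> and \<open>?E (Suc n)\<close> differ by a null set.\<close>
    have "prob (?C (Suc n)) = prob (cyl n ?h)" by (simp add: prob_cyl_Suc trans_def True p_0)
    moreover have "prob (cyl n ?h - ?C (Suc n)) = prob (cyl n ?h) - prob (?C (Suc n))"
      by (rule finite_measure_Diff) (auto simp: cyl_Suc)
    ultimately have null: "prob (cyl n ?h - ?C (Suc n)) = 0" by simp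
    have "prob ?F \<le> prob (?E (Suc n) \<union> (cyl n ?h - ?C (Suc n)))"
      by (rule finite_measure_mono) (use F_sub meas[OF B] in auto)
    also have "\<dots> \<le> prob (?E (Suc n)) + prob (cyl n ?h - ?C (Suc n))"
      by (rule measure_Un_le) (use meas[OF B] in auto)
    finally have "prob ?F \<le> prob (?E (Suc n))" using null by simp
    moreover have "prob (?E (Suc n)) \<le> prob ?F"
      by (rule finite_measure_mono[OF E_sub meas[OF A]])
    ultimately have "prob ?F = prob (?E (Suc n))" by simp
    then show ?thesis using E[of "Suc n"] by (simp add: True trans_def p_0)
  next
    case False
    let ?N = "cyl n ?h - (?C (Suc n) \<union> ?C (n - 1))"
    have disj: "?C (Suc n) \<inter> ?C (n - 1) = {}" by (auto simp: cyl_Suc)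
    have "prob (?C (Suc n) \<union> ?C (n - 1)) = prob (?C (Suc n)) + prob (?C (n - 1))"
      by (rule finite_measure_Union) (use disj in auto)
    also have "\<dots> = prob (cyl n ?h)"
      using False by (simp add: prob_cyl_Suc trans_def left_diff_distrib)
    finally have "prob (?C (Suc n) \<union> ?C (n - 1)) = prob (cyl n ?h)" .
    moreover have "prob ?N = prob (cyl n ?h) - prob (?C (Suc n) \<union> ?C (n - 1))"
      by (rule finite_measure_Diff) (auto simp: cyl_Suc)
    ultimately have null: "prob ?N = 0" by simp
    have EE: "prob (?E (Suc n) \<union> ?E (n - 1)) = prob (?E (Suc n)) + prob (?E (n - 1))"
      by (rule finite_measure_Union) (use disj meas[OF B] in auto)
    have "prob ?F \<le> prob ((?E (Suc n) \<union> ?E (n - 1)) \<union> ?N)"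
    proof (rule finite_measure_mono)
      show "?F \<subseteq> (?E (Suc n) \<union> ?E (n - 1)) \<union> ?N" using F_sub by blast
    qed (use meas[OF B] in auto)
    also have "\<dots> \<le> prob (?E (Suc n) \<union> ?E (n - 1)) + prob ?N"
      by (rule measure_Un_le) (use meas[OF B] in auto)
    finally have "prob ?F \<le> prob (?E (Suc n) \<union> ?E (n - 1))" using null by simp
    moreover have "prob (?E (Suc n) \<union> ?E (n - 1)) \<le> prob ?F"
      by (rule finite_measure_mono[OF Un_least[OF E_sub E_sub] meas[OF A]])
    ultimately have "prob ?F = prob (?E (Suc n)) + prob (?E (n - 1))" using EE by simp
    moreover have "trans n (Suc n) = p n" "trans n (n - 1) = 1 - p n"
      using False by (auto simp: trans_def)
    ultimately show ?thesis by (simp only: E) (simp add: algebra_simps)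
  qed
  then have "measure (Q n) A * prob (cyl n ?h)
      = (p n * measure (Q (Suc n)) B + (1 - p n) * measure (Q (n - 1)) B) * prob (cyl n ?h)"
    using prob_cyl_future[OF A, of n ?h] by simp
  then show ?thesis using prob_cyl_id[of n] by (simp add: B_def)
qed

lemma bd_laws_Q: "bd_laws p Q"
proof (rule bd_laws.intro)
  show "prob_space (Q n)" for n
    unfolding Q_def by (rule prob_space_law) (use prob_cyl_id[of n] in simp)
  show "sets (Q n) = sets path_space" for n by (simp add: Q_def sets_law)
qed (fact p_0 p_gt_0 p_lt_1 Q_first_step)+

text \<open>Transfers almost sure statements from \<open>Q 0\<close> back to the given chain: since
  \<open>X 0 = 0\<close>, the cylinder at time 0 is the whole space.\<close>

lemma AE_future_0:
  assumes "Measurable.pred path_space \<phi>" and "measure (Q 0) {\<omega>. \<phi> \<omega>} = 1"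
  shows "AE \<omega> in M. \<phi> (to_stream (\<lambda>k. X k \<omega>))"
proof -
  have S: "{\<omega>. \<phi> \<omega>} \<in> sets path_space" by (rule pred_path_space_iff[THEN iffD1, OF assms(1)])
  have c: "cyl 0 (\<lambda>i. i) = space M" by (auto simp: cyl_def X_0)
  have "prob {\<omega>\<in>space M. \<phi> (future 0 \<omega>)} = 1"
    using prob_cyl_future[OF S, of 0 "\<lambda>i. i"] assms(2) by (simp add: c prob_space)
  moreover have "{\<omega>\<in>space M. \<phi> (future 0 \<omega>)} \<in> events"
    using measurable_sets[OF future_measurable S, of 0] by (simp add: vimage_def Int_def conj_commute)
  ultimately have "AE \<omega> in M. \<phi> (future 0 \<omega>)"
    using prob_eq_1[of "{\<omega>\<in>space M. \<phi> (future 0 \<omega>)}"] by simp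
  then show ?thesis by (simp add: future_def)
qed

end

section \<open>Finitely many sites: the block argument\<close>

lemma alw_ne_Stream: "alw (\<lambda>\<omega>. shd \<omega> \<noteq> x) (m ## \<omega>) \<longleftrightarrow> m \<noteq> x \<and> alw (\<lambda>\<omega>. shd \<omega> \<noteq> x) \<omega>"
  by (subst alw.simps) simp

context bd_laws
begin

text \<open>As a function of the starting point, the probability of \<open>L\<close> while avoiding
  \<open>a\<close> vanishes at \<open>a\<close> and is harmonic up to \<open>b\<close>, so its
  values at \<open>a + 1\<close> and \<open>b\<close> differ by the scale factor. The factor
  \<open>1 / scale p a b\<close> is the price for reaching \<open>b\<close> before
  \<open>a\<close>.\<close>

lemma Pr_avoid:
  assumes [measurable]: "Measurable.pred path_space L"
    and inv: "\<And>m \<omega>. a < m \<Longrightarrow> m < b \<Longrightarrow> L (m ## \<omega>) \<longleftrightarrow> L \<omega>"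
    and "a < b"
  shows "Pr (Suc a) (\<lambda>\<omega>. alw (\<lambda>\<omega>. shd \<omega> \<noteq> a) \<omega> \<and> L \<omega>)
    = Pr b (\<lambda>\<omega>. alw (\<lambda>\<omega>. shd \<omega> \<noteq> a) \<omega> \<and> L \<omega>) / scale p a b"
proof -
  let ?f = "\<lambda>m. Pr m (\<lambda>\<omega>. alw (\<lambda>\<omega>. shd \<omega> \<noteq> a) \<omega> \<and> L \<omega>)"
  have step: "?f m = p m * Pr (Suc m) (\<lambda>\<omega>. m \<noteq> a \<and> alw (\<lambda>\<omega>. shd \<omega> \<noteq> a) \<omega> \<and> L (m ## \<omega>))
      + (1 - p m) * Pr (m - 1) (\<lambda>\<omega>. m \<noteq> a \<and> alw (\<lambda>\<omega>. shd \<omega> \<noteq> a) \<omega> \<and> L (m ## \<omega>))" for m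
    by (subst Pr_step, measurable) (simp only: alw_ne_Stream conj_assoc)
  have "?f a = 0" using step[of a] by (simp add: Pr_False)
  moreover have "?f m = p m * ?f (Suc m) + (1 - p m) * ?f (m - 1)" if "a < m" "m < b" for m
    using step[of m] that by (simp add: inv)
  ultimately have "?f b = ?f (Suc a) * scale p a b"
    by (intro harmonic_eq_scale[of ?f a b b]) (use \<open>a < b\<close> in auto)
  then show ?thesis using scale_ge_1[OF \<open>a < b\<close>] by (simp add: field_simps)
qed

text \<open>Such a site is visited exactly once and is left upwards for good; these are the sites
  whose expected number is compared with \<open>1 / D(i)\<close>.\<close>

definition strong_cut :: "nat \<Rightarrow> nat stream \<Rightarrow> bool" where
  "strong_cut i = first_hit i (\<lambda>\<omega>. shd (stl \<omega>) = Suc i \<and> alw (\<lambda>\<omega>. shd \<omega> \<noteq> i) (stl \<omega>))"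

lemma strong_cut_measurable [measurable]: "Measurable.pred path_space (strong_cut i)"
  unfolding strong_cut_def by measurable

lemma strong_cut_Stream:
  "strong_cut i (m ## \<omega>) \<longleftrightarrow>
    (if m = i then shd \<omega> = Suc i \<and> alw (\<lambda>\<omega>. shd \<omega> \<noteq> i) \<omega> else strong_cut i \<omega>)"
  by (simp add: strong_cut_def first_hit_SCons)

text \<open>Prefix invariance moves the start from 0 to \<open>i\<close>. There the first step must
  go up, which costs \<open>p i\<close>; the downward alternative contradicts
  \<open>shd \<omega> = Suc i\<close>.\<close>

lemma Pr_strong_cut_and:
  assumes [measurable]: "Measurable.pred path_space L"
    and inv: "\<And>m \<omega>. m \<le> i \<Longrightarrow> L (m ## \<omega>) \<longleftrightarrow> L \<omega>"
  shows "Pr 0 (\<lambda>\<omega>. strong_cut i \<omega> \<and> L \<omega>)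
    = p i * Pr (Suc i) (\<lambda>\<omega>. alw (\<lambda>\<omega>. shd \<omega> \<noteq> i) \<omega> \<and> L \<omega>)"
proof -
  let ?E = "\<lambda>\<omega>. shd \<omega> = Suc i \<and> alw (\<lambda>\<omega>. shd \<omega> \<noteq> i) \<omega> \<and> L \<omega>"
  have "Pr 0 (\<lambda>\<omega>. strong_cut i \<omega> \<and> L \<omega>) = Pr i (\<lambda>\<omega>. strong_cut i \<omega> \<and> L \<omega>)"
    by (rule Pr_eq_of_prefix_invariant, measurable) (simp_all add: strong_cut_Stream inv)
  also have "\<dots> = p i * Pr (Suc i) ?E + (1 - p i) * Pr (i - 1) ?E"
    by (subst Pr_step, measurable) (simp add: strong_cut_Stream inv)
  also have "Pr (Suc i) ?E = Pr (Suc i) (\<lambda>\<omega>. alw (\<lambda>\<omega>. shd \<omega> \<noteq> i) \<omega> \<and> L \<omega>)"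
    by (rule Pr_start) measurable
  also have "Pr (i - 1) ?E = Pr (i - 1) (\<lambda>_. False)"
    by (rule Pr_start_cong, measurable) auto
  finally show ?thesis by (simp add: Pr_False)
qed

lemma Pr_strong_cut_le: "Pr 0 (strong_cut i) \<le> escape i"
proof -
  have "Pr 0 (strong_cut i) = p i * escape i"
    using Pr_strong_cut_and[of "\<lambda>_. True" i] by (simp add: escape_def)
  then show ?thesis using p_le_1[of i] escape_nonneg[of i] by (simp add: mult_left_le_one_le p_pos less_imp_le)
qed

lemma rho_prod_le_1:
  assumes "\<And>k. m < k \<Longrightarrow> rho p k \<le> 1"
  shows "rho_prod p m n \<le> 1"
  unfolding rho_prod_def by (intro prod_le_1) (use assms rho_nonneg in auto)

lemma scale_le_diff:
  assumes "\<And>k. m < k \<Longrightarrow> rho p k \<le> 1" "m \<le> n"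
  shows "scale p m n \<le> real (n - m)"
proof -
  have "scale p m n \<le> (\<Sum>j\<in>{m..<n}. 1)"
    unfolding scale_def by (intro sum_mono rho_prod_le_1 assms)
  then show ?thesis by simp
qed

lemma p_ge_half: "rho p k \<le> 1 \<Longrightarrow> 1 / 2 \<le> p k"
  using p_pos[of k] by (simp add: rho_def divide_le_eq)

text \<open>Only sites from \<open>n\<close> on are mentioned, so the event inherits from
  \<open>G\<close> the invariance under steps below \<open>n\<close>; for distinct
  \<open>n \<le> N\<close> the events are disjoint.\<close>

definition last_site :: "(nat \<Rightarrow> nat stream \<Rightarrow> bool) \<Rightarrow> nat \<Rightarrow> nat \<Rightarrow> nat stream \<Rightarrow> bool" where
  "last_site G N n \<omega> \<longleftrightarrow> G n \<omega> \<and> (\<forall>m\<in>{n<..N}. \<not> G m \<omega>)"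

lemma last_site_measurable [measurable]:
  assumes [measurable]: "\<And>n. Measurable.pred path_space (G n)"
  shows "Measurable.pred path_space (last_site G N n)"
  unfolding last_site_def by measurable

lemma Pr_sum_le_disjoint:
  assumes [measurable]: "Measurable.pred path_space \<psi>" "\<And>n. Measurable.pred path_space (\<phi> n)"
    and "finite I" and disj: "\<And>m n \<omega>. m \<in> I \<Longrightarrow> n \<in> I \<Longrightarrow> \<phi> m \<omega> \<Longrightarrow> \<phi> n \<omega> \<Longrightarrow> m = n"
  shows "(\<Sum>n\<in>I. Pr k (\<lambda>\<omega>. \<psi> \<omega> \<and> \<phi> n \<omega>)) \<le> Pr k \<psi>"
proof -
  interpret prob_space "Q k" by (rule prob_space_Q)
  have "(\<Sum>n\<in>I. prob {\<omega>. \<psi> \<omega> \<and> \<phi> n \<omega>}) = prob (\<Union>n\<in>I. {\<omega>. \<psi> \<omega> \<and> \<phi> n \<omega>})"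
  proof (rule finite_measure_finite_Union[symmetric])
    show "(\<lambda>n. {\<omega>. \<psi> \<omega> \<and> \<phi> n \<omega>}) ` I \<subseteq> events"
      by (intro image_subsetI sets_Q_pred) measurable
    show "disjoint_family_on (\<lambda>n. {\<omega>. \<psi> \<omega> \<and> \<phi> n \<omega>}) I"
      using disj unfolding disjoint_family_on_def by blast
  qed fact
  also have "\<dots> \<le> prob {\<omega>. \<psi> \<omega>}"
    by (rule finite_measure_mono[OF _ sets_Q_pred[OF assms(1)]]) blast
  finally show ?thesis by (simp add: Pr_def)
qed

lemma Pr_ex_le_sum:
  assumes [measurable]: "\<And>n. Measurable.pred path_space (\<phi> n)" and "finite I"
  shows "Pr k (\<lambda>\<omega>. \<exists>n\<in>I. \<phi> n \<omega>) \<le> (\<Sum>n\<in>I. Pr k (\<phi> n))"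
proof -
  interpret prob_space "Q k" by (rule prob_space_Q)
  have "prob (\<Union>n\<in>I. {\<omega>. \<phi> n \<omega>}) \<le> (\<Sum>n\<in>I. prob {\<omega>. \<phi> n \<omega>})"
    by (rule finite_measure_subadditive_finite[OF \<open>finite I\<close>]) (intro image_subsetI sets_Q_pred, measurable)
  moreover have "(\<Union>n\<in>I. {\<omega>. \<phi> n \<omega>}) = {\<omega>. \<exists>n\<in>I. \<phi> n \<omega>}" by blast
  ultimately show ?thesis by (simp add: Pr_def)
qed

end

text \<open>The indices \<open>i\<close> with \<open>n - i \<le> K\<close> already contribute a full
  harmonic sum; \<open>2 * K < n\<close> puts them all above \<open>K\<close>.\<close>

lemma sum_inverse_distance_ge_ln:
  assumes "2 * K < n"
  shows "ln (real K + 1) \<le> (\<Sum>i\<in>{K<..<n}. 1 / real (n - i))"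
proof -
  have "harm K = (\<Sum>d\<in>{1..K}. 1 / real d)"
    by (simp add: harm_def inverse_eq_divide)
  also have "\<dots> = (\<Sum>i\<in>{n-K..<n}. 1 / real (n - i))"
    by (rule sum.reindex_bij_witness[where i = "\<lambda>i. n - i" and j = "\<lambda>d. n - d"]) (use assms in auto)
  also have "\<dots> \<le> (\<Sum>i\<in>{K<..<n}. 1 / real (n - i))"
    by (rule sum_mono2) (use assms in auto)
  finally show ?thesis using ln_le_harm[of K] by simp
qed

text \<open>Each block is the union of two consecutive dyadic blocks, so every index is counted at
  most twice.\<close>

lemma summable_dyadic_blocks:
  fixes e :: "nat \<Rightarrow> real"
  assumes "summable e" and nonneg: "\<And>i. 0 \<le> e i"
  shows "summable (\<lambda>j. \<Sum>i\<in>{2^j<..4 * 2^j}. e i)"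
proof -
  define b where "b j = (\<Sum>i\<in>{2^j<..2 * 2^j}. e i)" for j :: nat
  have eq: "(\<Sum>i\<in>{2^j<..4 * 2^j}. e i) = b j + b (Suc j)" for j :: nat
  proof -
    have "{2^j<..4 * 2^j} = {2^j<..2 * 2^j} \<union> {2 * 2^j<..2 * (2 * 2^j :: nat)}" by auto
    then show ?thesis unfolding b_def by (simp, subst sum.union_disjoint) auto
  qed
  have part: "(\<Sum>j<J. b j) = (\<Sum>i\<in>{1<..2^J}. e i)" for J :: nat
  proof (induction J)
    case (Suc J)
    have "{1<..2 * 2^J} = {1<..2^J} \<union> {2^J<..2 * 2^J :: nat}"
      using one_le_power[of "2::nat" J] by auto
    then have "(\<Sum>i\<in>{1<..2 * 2^J}. e i) = (\<Sum>i\<in>{1<..2^J}. e i) + b J"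
      unfolding b_def by (simp, subst sum.union_disjoint) auto
    then show ?case using Suc by simp
  qed simp
  have "summable b"
  proof (rule summableI_nonneg_bounded)
    show "0 \<le> b j" for j by (simp add: b_def sum_nonneg nonneg)
    show "(\<Sum>j<J. b j) \<le> suminf e" for J
      unfolding part by (rule sum_le_suminf[OF assms(1)]) (use nonneg in auto)
  qed
  then show ?thesis unfolding eq by (intro summable_add) (simp_all add: summable_Suc_iff)
qed

lemma ex_dyadic_block:
  assumes "2 * 2^J < (n::nat)"
  shows "\<exists>j\<ge>J. n \<in> {2 * 2^j<..4 * 2^j}"
proof -
  have "2 \<le> n" using assms by (metis One_nat_def Suc_1 Suc_leI le_trans less_imp_le mult_le_mono2 nat_mult_1_right one_le_numeral one_le_power)
  then obtain i where i: "2 ^ i < n" "n \<le> 2 ^ (i + 1)" using ex_power_ivl2[of 2 n] by auto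
  have "2 ^ Suc J < n" using assms by simp
  then have "(2::nat) ^ Suc J < 2 ^ (i + 1)" using i(2) by (rule less_le_trans)
  then have "Suc J < i + 1" by (rule power_less_imp_less_exp[rotated]) simp
  then obtain j where "i = Suc j" "J \<le> j" by (cases i) auto
  then show ?thesis using i by (intro exI[of _ j]) auto
qed

section \<open>The block estimate for a general type of site\<close>

context bd_laws
begin

text \<open>\<open>G n\<close> stands for "\<open>n\<close> is a site of the given type". The
  assumption \<open>above\<close> carries the information specific to the type: if \<open>n\<close>
  is the last such site up to \<open>N\<close>, then a path started at \<open>n\<close> stays at or
  above \<open>n\<close> with conditional probability at least \<open>c\<close>.\<close>

context
  fixes G :: "nat \<Rightarrow> nat stream \<Rightarrow> bool" and c :: real and n1 :: nat
  assumes G_meas [measurable]: "\<And>n. Measurable.pred path_space (G n)"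
    and G_prefix: "\<And>m n \<omega>. m < n \<Longrightarrow> G n (m ## \<omega>) \<longleftrightarrow> G n \<omega>"
    and c_pos: "0 < c"
    and above: "\<And>n N. n1 \<le> n \<Longrightarrow>
      c * Pr n (last_site G N n) \<le> Pr n (\<lambda>\<omega>. last_site G N n \<omega> \<and> alw (HLD {n..}) \<omega>)"
    and rho_le: "\<And>k. n1 \<le> k \<Longrightarrow> rho p k \<le> 1"
begin

lemma last_site_prefix: "m < n \<Longrightarrow> last_site G N n (m ## \<omega>) \<longleftrightarrow> last_site G N n \<omega>"
  by (auto simp: last_site_def G_prefix)

text \<open>Three factors: the step up at \<open>i\<close> costs \<open>p i \<ge> 1 / 2\<close>,
  reaching \<open>n\<close> from \<open>i + 1\<close> before \<open>i\<close> costs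
  \<open>1 / scale p i n \<ge> 1 / (n - i)\<close>, and staying at or above \<open>n\<close>
  afterwards, hence away from \<open>i\<close>, costs \<open>c\<close>.\<close>

lemma Pr_strong_cut_last_site:
  assumes "n1 \<le> i" "i < n"
  shows "c / 2 * (1 / real (n - i)) * Pr 0 (last_site G N n) \<le> Pr 0 (\<lambda>\<omega>. strong_cut i \<omega> \<and> last_site G N n \<omega>)"
proof -
  let ?L = "last_site G N n"
  have avoid: "alw (\<lambda>\<omega>. shd \<omega> \<noteq> i) \<omega>" if "alw (HLD {n..}) \<omega>" for \<omega>
    using that by (rule alw_mono) (use \<open>i < n\<close> in \<open>auto simp: HLD_iff\<close>)
  have Ln: "Pr 0 ?L = Pr n ?L"
    by (rule Pr_eq_of_prefix_invariant, measurable) (simp_all add: last_site_prefix)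
  have s: "0 < scale p i n" "scale p i n \<le> real (n - i)"
    using scale_ge_1[OF \<open>i < n\<close>] scale_le_diff[of i n] rho_le assms by auto
  have "c * Pr n ?L \<le> Pr n (\<lambda>\<omega>. ?L \<omega> \<and> alw (HLD {n..}) \<omega>)" using above assms by simp
  also have "\<dots> \<le> Pr n (\<lambda>\<omega>. alw (\<lambda>\<omega>. shd \<omega> \<noteq> i) \<omega> \<and> ?L \<omega>)"
    by (rule Pr_mono, measurable) (use avoid in blast)
  finally have "c * Pr n ?L / scale p i n \<le> Pr (Suc i) (\<lambda>\<omega>. alw (\<lambda>\<omega>. shd \<omega> \<noteq> i) \<omega> \<and> ?L \<omega>)"
    using s \<open>i < n\<close> by (subst Pr_avoid[where b = n]) (auto simp: last_site_prefix divide_right_mono)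
  moreover have "c * Pr n ?L / real (n - i) \<le> c * Pr n ?L / scale p i n"
    using s c_pos Pr_nonneg by (intro divide_left_mono) auto
  ultimately have "c * Pr n ?L / real (n - i) \<le> Pr (Suc i) (\<lambda>\<omega>. alw (\<lambda>\<omega>. shd \<omega> \<noteq> i) \<omega> \<and> ?L \<omega>)"
    by simp
  then have "1 / 2 * (c * Pr n ?L / real (n - i)) \<le> p i * Pr (Suc i) (\<lambda>\<omega>. alw (\<lambda>\<omega>. shd \<omega> \<noteq> i) \<omega> \<and> ?L \<omega>)"
    using p_ge_half[OF rho_le[OF assms(1)]] c_pos Pr_nonneg by (intro mult_mono) auto
  moreover have "Pr 0 (\<lambda>\<omega>. strong_cut i \<omega> \<and> ?L \<omega>) = p i * Pr (Suc i) (\<lambda>\<omega>. alw (\<lambda>\<omega>. shd \<omega> \<noteq> i) \<omega> \<and> ?L \<omega>)"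
    by (rule Pr_strong_cut_and, measurable) (use \<open>i < n\<close> in \<open>simp add: last_site_prefix\<close>)
  ultimately show ?thesis by (simp add: Ln)
qed

text \<open>Sum the previous bound over the last site \<open>n\<close> and over \<open>i\<close>
  with \<open>K < i < n\<close>. The inverse distances give the logarithm; disjointness of the
  last-site events bounds the double sum by the expected number of strong cuts in the block.
  Starting the block at \<open>2 * K\<close> leaves enough room below every
  \<open>n\<close>.\<close>

lemma Pr_site_in_block:
  assumes "n1 \<le> K"
  shows "c / 2 * ln (real K + 1) * Pr 0 (\<lambda>\<omega>. \<exists>n\<in>{2*K<..4*K}. G n \<omega>) \<le> (\<Sum>i\<in>{K<..4*K}. escape i)"
proof -
  let ?B = "{2*K<..4*K}" and ?L = "last_site G (4*K)"
  have ex: "(\<exists>n\<in>?B. ?L n \<omega>)" if "\<exists>n\<in>?B. G n \<omega>" for \<omega>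
  proof -
    let ?S = "{n\<in>?B. G n \<omega>}"
    define x where "x = Max ?S"
    have fin: "finite ?S" by simp
    have x: "x \<in> ?S" unfolding x_def by (rule Max_in[OF fin]) (use that in blast)
    have "\<not> G m \<omega>" if "m \<in> {x<..4*K}" for m
    proof
      assume "G m \<omega>"
      then have "m \<in> ?S" using that x by simp
      then have "m \<le> x" unfolding x_def by (rule Max_ge[OF fin])
      then show False using that by simp
    qed
    then show ?thesis using x unfolding last_site_def by blast
  qed
  have L_meas: "Measurable.pred path_space (?L n)" for n by measurable
  have "Pr 0 (\<lambda>\<omega>. \<exists>n\<in>?B. G n \<omega>) \<le> Pr 0 (\<lambda>\<omega>. \<exists>n\<in>?B. ?L n \<omega>)"
    by (rule Pr_mono[OF _ ex], measurable)
  also have "\<dots> \<le> (\<Sum>n\<in>?B. Pr 0 (?L n))" by (rule Pr_ex_le_sum[OF L_meas]) simp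
  finally have "c / 2 * ln (real K + 1) * Pr 0 (\<lambda>\<omega>. \<exists>n\<in>?B. G n \<omega>)
      \<le> c / 2 * ln (real K + 1) * (\<Sum>n\<in>?B. Pr 0 (?L n))"
    using c_pos by (intro mult_left_mono) auto
  also have "\<dots> = (\<Sum>n\<in>?B. c / 2 * Pr 0 (?L n) * ln (real K + 1))"
    by (simp add: sum_distrib_left mult_ac)
  also have "\<dots> \<le> (\<Sum>n\<in>?B. c / 2 * Pr 0 (?L n) * (\<Sum>i\<in>{K<..<n}. 1 / real (n - i)))"
    using c_pos Pr_nonneg by (intro sum_mono mult_left_mono sum_inverse_distance_ge_ln) auto
  also have "\<dots> = (\<Sum>n\<in>?B. \<Sum>i\<in>{K<..<n}. c / 2 * (1 / real (n - i)) * Pr 0 (?L n))"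
    by (intro sum.cong refl, subst sum_distrib_left, intro sum.cong refl) (simp only: mult_ac)
  also have "\<dots> \<le> (\<Sum>n\<in>?B. \<Sum>i\<in>{K<..<n}. Pr 0 (\<lambda>\<omega>. strong_cut i \<omega> \<and> ?L n \<omega>))"
    using assms by (intro sum_mono Pr_strong_cut_last_site) auto
  also have "\<dots> \<le> (\<Sum>n\<in>?B. \<Sum>i\<in>{K<..4*K}. Pr 0 (\<lambda>\<omega>. strong_cut i \<omega> \<and> ?L n \<omega>))"
    by (intro sum_mono sum_mono2) (auto simp: Pr_nonneg)
  also have "\<dots> = (\<Sum>i\<in>{K<..4*K}. \<Sum>n\<in>?B. Pr 0 (\<lambda>\<omega>. strong_cut i \<omega> \<and> ?L n \<omega>))"
    by (rule sum.swap)
  also have "\<dots> \<le> (\<Sum>i\<in>{K<..4*K}. Pr 0 (strong_cut i))"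
  proof (intro sum_mono Pr_sum_le_disjoint strong_cut_measurable L_meas)
    fix m n \<omega> assume "m \<in> ?B" "n \<in> ?B" "?L m \<omega>" "?L n \<omega>"
    then show "m = n" unfolding last_site_def by (cases m n rule: linorder_cases) auto
  qed simp
  also have "\<dots> \<le> (\<Sum>i\<in>{K<..4*K}. escape i)"
    by (intro sum_mono Pr_strong_cut_le)
  finally show ?thesis .
qed

text \<open>For \<open>K = 2^j\<close> the logarithm in the block estimate is at least
  \<open>j * ln 2\<close>, and \<open>ln i\<close> is of the same order throughout the block. So the
  block probabilities are dominated by blocks of the convergent series, and Borel--Cantelli
  applies.\<close>

theorem finitely_many_sites:
  assumes sum: "summable (\<lambda>n. escape (n + 2) / ln (real (n + 2)))"
  shows "AE \<omega> in Q 0. finite {n. G n \<omega>}"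
proof -
  define A where "A j = {\<omega>. \<exists>n\<in>{2 * 2^j<..4 * 2^j}. G n \<omega>}" for j :: nat
  \<comment> \<open>\<open>e 1\<close> is 0, being a quotient by \<open>ln 1 = 0\<close>; all blocks
    used consist of indices from 2 on.\<close>
  define e where "e i = escape i / ln (real i)" for i
  have e_nonneg: "0 \<le> e i" for i
    using escape_nonneg[of i] by (cases "i = 0") (auto simp: e_def)
  have "summable e" using sum summable_iff_shift[of e 2] by (simp add: e_def)
  then have S: "summable (\<lambda>j. \<Sum>i\<in>{2^j<..4 * 2^j}. e i)" by (rule summable_dyadic_blocks) (rule e_nonneg)
  interpret prob_space "Q 0" by (rule prob_space_Q)
  have A_sets: "A j \<in> events" for j unfolding A_def by (rule sets_Q_pred) measurable
  \<comment> \<open>The 6 is \<open>3 * 2\<close>: the 3 comes from \<open>j + 2 \<le> 3 * j\<close>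
    for \<open>j \<ge> 1\<close>, the 2 from the factor \<open>c / 2\<close> of the block
    estimate.\<close>
  have bound: "prob (A j) \<le> 6 / c * (\<Sum>i\<in>{2^j<..4 * 2^j}. e i)" if "n1 \<le> j" "1 \<le> j" for j
  proof -
    let ?l = "real j * ln 2"
    have l: "0 < ?l" using that by simp
    have "n1 \<le> 2 ^ j" using that less_exp[of j] by linarith
    then have *: "c / 2 * ln (real (2^j) + 1) * prob (A j) \<le> (\<Sum>i\<in>{2^j<..4 * 2^j}. escape i)"
      using Pr_site_in_block[of "2^j"] by (simp add: Pr_def A_def)
    have "?l = ln (2 ^ j)" by (simp add: ln_realpow)
    also have "\<dots> \<le> ln (real (2^j) + 1)" by (rule ln_mono) simp_all
    finally have "c / 2 * ?l * prob (A j) \<le> c / 2 * ln (real (2^j) + 1) * prob (A j)"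
      using c_pos by (intro mult_right_mono mult_left_mono) auto
    also note *
    also have "(\<Sum>i\<in>{2^j<..4 * 2^j}. escape i) \<le> (\<Sum>i\<in>{2^j<..4 * 2^j}. 3 * ?l * e i)"
    proof (rule sum_mono)
      fix i :: nat assume i: "i \<in> {2^j<..4 * 2^j}"
      have i1: "1 < i" using i one_le_power[of "2::nat" j] by simp
      have "real i \<le> real (4 * 2 ^ j)" using i by (simp only: of_nat_le_iff) simp
      then have "real i \<le> 2 ^ (j + 2)" by simp
      then have "ln (real i) \<le> ln (2 ^ (j + 2))" using i1 by simp
      also have "\<dots> = real (j + 2) * ln 2" by (simp only: ln_realpow zero_less_numeral)
      also have "\<dots> \<le> 3 * ?l" using that by (simp add: mult_right_mono)
      finally have "ln (real i) * e i \<le> 3 * ?l * e i" by (rule mult_right_mono) (rule e_nonneg)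
      then show "escape i \<le> 3 * ?l * e i" using i1 by (simp add: e_def)
    qed
    also have "\<dots> = 3 * ?l * (\<Sum>i\<in>{2^j<..4 * 2^j}. e i)" by (simp add: sum_distrib_left)
    finally have "?l * (c / 2 * prob (A j)) \<le> ?l * (3 * (\<Sum>i\<in>{2^j<..4 * 2^j}. e i))"
      by (simp only: mult_ac)
    then have "c / 2 * prob (A j) \<le> 3 * (\<Sum>i\<in>{2^j<..4 * 2^j}. e i)"
      using l by (simp only: mult_le_cancel_left_pos)
    then show ?thesis using c_pos by (simp add: field_simps)
  qed
  have "summable (\<lambda>j. prob (A j))"
  proof (rule summable_comparison_test_ev)
    show "\<forall>\<^sub>F j in sequentially. norm (prob (A j)) \<le> 6 / c * (\<Sum>i\<in>{2^j<..4 * 2^j}. e i)"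
      using eventually_ge_at_top[of "max n1 1"] by eventually_elim (use bound in simp)
    show "summable (\<lambda>j. 6 / c * (\<Sum>i\<in>{2^j<..4 * 2^j}. e i))" by (rule summable_mult[OF S])
  qed
  then have "AE \<omega> in Q 0. \<forall>\<^sub>F j in sequentially. \<omega> \<in> space (Q 0) - A j"
    by (intro borel_cantelli_AE1) (auto simp: A_sets emeasure_eq_measure)
  then show ?thesis
  proof eventually_elim
    fix \<omega> assume "\<forall>\<^sub>F j in sequentially. \<omega> \<in> space (Q 0) - A j"
    then obtain J where J: "\<And>j. J \<le> j \<Longrightarrow> \<omega> \<notin> A j" by (auto simp: eventually_sequentially)
    have "{n. G n \<omega>} \<subseteq> {..2 * 2^J}"
    proof (rule subsetI, rule ccontr)
      fix n assume n: "n \<in> {n. G n \<omega>}" "n \<notin> {..2 * 2^J}"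
      then have "2 * 2^J < n" by simp
      then obtain j where "J \<le> j" "n \<in> {2 * 2^j<..4 * 2^j}" using ex_dyadic_block by blast
      then show False using J[of j] n(1) by (auto simp: A_def)
    qed
    then show "finite {n. G n \<omega>}" by (rule finite_subset) simp
  qed
qed

end

end

section \<open>Upcrossing numbers and weak cutpoints\<close>

definition visits :: "nat \<Rightarrow> nat stream \<Rightarrow> nat set" where
  "visits x \<omega> = {k. \<omega> !! k = x}"

definition ups :: "nat \<Rightarrow> nat stream \<Rightarrow> nat set" where
  "ups x \<omega> = {k. \<omega> !! k = x \<and> \<omega> !! Suc k = Suc x}"

definition has_ups :: "nat \<Rightarrow> nat \<Rightarrow> nat stream \<Rightarrow> bool" where
  "has_ups a x \<omega> \<longleftrightarrow> finite (ups x \<omega>) \<and> card (ups x \<omega>) = a"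

definition weak_cut :: "nat \<Rightarrow> nat stream \<Rightarrow> bool" where
  "weak_cut n \<omega> \<longleftrightarrow> (\<exists>k. \<omega> !! k = n \<and> (\<forall>i<k. \<omega> !! i \<in> {..n}) \<and> (\<forall>i>k. \<omega> !! i \<in> {n..}))"

lemma visits_Stream:
  "visits x (m ## \<omega>) = (if m = x then insert 0 (Suc ` visits x \<omega>) else Suc ` visits x \<omega>)"
proof -
  have "k \<in> visits x (m ## \<omega>) \<longleftrightarrow> (k = 0 \<and> m = x) \<or> k \<in> Suc ` visits x \<omega>" for k
    by (cases k) (auto simp: visits_def)
  then show ?thesis by auto
qed

lemma ups_Stream:
  "ups x (m ## \<omega>) = (if m = x \<and> shd \<omega> = Suc x then insert 0 (Suc ` ups x \<omega>) else Suc ` ups x \<omega>)"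
proof -
  have "k \<in> ups x (m ## \<omega>) \<longleftrightarrow> (k = 0 \<and> m = x \<and> shd \<omega> = Suc x) \<or> k \<in> Suc ` ups x \<omega>" for k
    by (cases k) (auto simp: ups_def)
  then show ?thesis by auto
qed

lemma finite_ups_Stream [simp]: "finite (ups x (m ## \<omega>)) \<longleftrightarrow> finite (ups x \<omega>)"
  by (simp add: ups_Stream finite_image_iff)

lemma card_ups_Stream: "finite (ups x \<omega>) \<Longrightarrow>
    card (ups x (m ## \<omega>)) = (if m = x \<and> shd \<omega> = Suc x then 1 else 0) + card (ups x \<omega>)"
  by (auto simp: ups_Stream card_image card_insert_if)

lemma finite_ups_shift [simp]: "finite (ups x (w @- \<omega>)) \<longleftrightarrow> finite (ups x \<omega>)"
  by (induction w) auto

lemma card_ups_shift_ge: "finite (ups x \<omega>) \<Longrightarrow> card (ups x \<omega>) \<le> card (ups x (w @- \<omega>))"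
  by (induction w) (auto simp: card_ups_Stream)

lemma ups_measurable [measurable]:
  "Measurable.pred path_space (\<lambda>\<omega>. finite (ups x \<omega>))"
  "(\<lambda>\<omega>. card (ups x \<omega>)) \<in> measurable path_space (count_space UNIV)"
  unfolding ups_def by measurable

lemma visits_measurable [measurable]:
  "Measurable.pred path_space (\<lambda>\<omega>. finite (visits x \<omega>))"
  "(\<lambda>\<omega>. card (visits x \<omega>)) \<in> measurable path_space (count_space UNIV)"
  unfolding visits_def by measurable

lemma has_ups_measurable [measurable]: "Measurable.pred path_space (has_ups a x)"
  unfolding has_ups_def by measurable

lemma weak_cut_measurable [measurable]: "Measurable.pred path_space (weak_cut n)"
proof -
  have [measurable]: "Measurable.pred path_space (\<lambda>\<omega>. \<omega> !! i \<in> A)" for i and A :: "nat set"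
    using pred_snth2[of "\<lambda>x _. x \<in> A" i i] .
  show ?thesis unfolding weak_cut_def by (intro pred_intros_countable pred_intros_logic) measurable
qed

lemma has_ups_prefix: "m < n \<Longrightarrow> has_ups a n (m ## \<omega>) \<longleftrightarrow> has_ups a n \<omega>"
  by (auto simp: has_ups_def card_ups_Stream)

lemma pred_shift:
  assumes "Measurable.pred path_space \<phi>"
  shows "Measurable.pred path_space (\<lambda>\<omega>. \<phi> (w @- \<omega>))"
  using assms
proof (induction w arbitrary: \<phi>)
  case (Cons m w)
  have [measurable]: "Measurable.pred path_space \<phi>" by fact
  have "Measurable.pred path_space (\<lambda>\<omega>. \<phi> (m ## \<omega>))" by measurable
  from Cons.IH[OF this] show ?case by simp
qed simp

section \<open>Decomposition at the first visit to a site\<close>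

definition first_hit_at :: "nat \<Rightarrow> nat \<Rightarrow> nat stream \<Rightarrow> bool" where
  "first_hit_at n t \<omega> \<longleftrightarrow> \<omega> !! t = n \<and> (\<forall>s<t. \<omega> !! s \<noteq> n)"

lemma first_hit_at_measurable [measurable]: "Measurable.pred path_space (first_hit_at n t)"
  unfolding first_hit_at_def by measurable

lemma first_hit_at_0: "first_hit_at n 0 \<omega> \<longleftrightarrow> shd \<omega> = n"
  by (simp add: first_hit_at_def)

lemma first_hit_at_Suc: "first_hit_at n (Suc t) (m ## \<omega>) \<longleftrightarrow> m \<noteq> n \<and> first_hit_at n t \<omega>"
  by (auto simp: first_hit_at_def All_less_Suc2)

lemma ev_iff_first_hit_at: "ev (\<lambda>\<omega>. shd \<omega> = n) \<omega> \<longleftrightarrow> (\<exists>t. first_hit_at n t \<omega>)"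
proof
  assume "ev (\<lambda>\<omega>. shd \<omega> = n) \<omega>"
  then have "\<exists>t. \<omega> !! t = n" by (simp add: ev_iff_sdrop)
  then have "\<omega> !! (LEAST t. \<omega> !! t = n) = n" by (rule LeastI_ex)
  then have "first_hit_at n (LEAST t. \<omega> !! t = n) \<omega>"
    unfolding first_hit_at_def using not_less_Least by blast
  then show "\<exists>t. first_hit_at n t \<omega>" by blast
qed (auto simp: first_hit_at_def ev_iff_sdrop)

context bd_laws
begin

text \<open>Inequalities for the path from \<open>n\<close> on carry over to paths that first reach
  \<open>n\<close> at time \<open>t\<close>. The word \<open>w\<close> is the stretch before that
  visit; it stays above \<open>n\<close> because the start does. Induction on \<open>t\<close>
  absorbs one letter at a time into the events. The condition on \<open>hd (w @ [n])\<close> says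
  that the path starts at \<open>m\<close>, also for empty \<open>w\<close>.\<close>

lemma Pr_first_hit_at_comparison:
  assumes "Measurable.pred path_space \<phi>" "Measurable.pred path_space \<psi>" "n \<le> m"
    and "\<And>w. set w \<subseteq> {n<..} \<Longrightarrow> hd (w @ [n]) = m \<Longrightarrow>
      c * Pr n (\<lambda>\<omega>. \<phi> (w @- \<omega>)) \<le> Pr n (\<lambda>\<omega>. \<psi> (w @- \<omega>))"
  shows "c * Pr m (\<lambda>\<omega>. \<phi> \<omega> \<and> first_hit_at n t \<omega>) \<le> Pr m (\<lambda>\<omega>. \<psi> \<omega> \<and> first_hit_at n t \<omega>)"
  using assms
proof (induction t arbitrary: m \<phi> \<psi>)
  case 0
  note [measurable] = 0(1,2)
  show ?case
  proof (cases "m = n")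
    case True
    have "Pr n (\<lambda>\<omega>. \<phi> \<omega> \<and> first_hit_at n 0 \<omega>) = Pr n \<phi>" "Pr n (\<lambda>\<omega>. \<psi> \<omega> \<and> first_hit_at n 0 \<omega>) = Pr n \<psi>"
      by (rule Pr_start_cong; measurable; simp add: first_hit_at_0)+
    then show ?thesis using 0(4)[of "[]"] True by simp
  next
    case False
    have "Pr m (\<lambda>\<omega>. \<phi> \<omega> \<and> first_hit_at n 0 \<omega>) = Pr m (\<lambda>_. False)"
      by (rule Pr_start_cong, measurable) (use False in \<open>simp add: first_hit_at_0\<close>)
    then show ?thesis by (simp add: Pr_False Pr_nonneg)
  qed
next
  case (Suc t)
  note [measurable] = Suc.prems(1,2)
  let ?f = "\<lambda>\<phi> k. Pr k (\<lambda>\<omega>. \<phi> (m ## \<omega>) \<and> m \<noteq> n \<and> first_hit_at n t \<omega>)"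
  have step: "Pr m (\<lambda>\<omega>. \<phi> \<omega> \<and> first_hit_at n (Suc t) \<omega>) = p m * ?f \<phi> (Suc m) + (1 - p m) * ?f \<phi> (m - 1)"
    if [measurable]: "Measurable.pred path_space \<phi>" for \<phi>
    by (subst Pr_step, measurable) (simp only: first_hit_at_Suc)
  show ?case
  proof (cases "m = n")
    case True
    then show ?thesis unfolding step[OF Suc.prems(1)] step[OF Suc.prems(2)] by (simp add: Pr_False)
  next
    case False
    then have m: "n < m" using Suc.prems(3) by simp
    have IH: "c * ?f \<phi> k \<le> ?f \<psi> k" if "n \<le> k" for k
    proof -
      have "c * Pr k (\<lambda>\<omega>. \<phi> (m ## \<omega>) \<and> first_hit_at n t \<omega>) \<le> Pr k (\<lambda>\<omega>. \<psi> (m ## \<omega>) \<and> first_hit_at n t \<omega>)"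
      proof (rule Suc.IH)
        fix w assume "set w \<subseteq> {n<..}" "hd (w @ [n]) = k"
        then show "c * Pr n (\<lambda>\<omega>. \<phi> (m ## (w @- \<omega>))) \<le> Pr n (\<lambda>\<omega>. \<psi> (m ## (w @- \<omega>)))"
          using Suc.prems(4)[of "m # w"] m by simp
      qed (measurable, rule that)
      then show ?thesis using False by simp
    qed
    have "c * (p m * ?f \<phi> (Suc m) + (1 - p m) * ?f \<phi> (m - 1))
        = p m * (c * ?f \<phi> (Suc m)) + (1 - p m) * (c * ?f \<phi> (m - 1))" by (simp only: distrib_left mult_ac)
    also have "\<dots> \<le> p m * ?f \<psi> (Suc m) + (1 - p m) * ?f \<psi> (m - 1)"
      using IH[of "Suc m"] IH[of "m - 1"] m p_pos[of m] p_le_1[of m]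
      by (intro add_mono mult_left_mono) auto
    finally show ?thesis unfolding step[OF Suc.prems(1)] step[OF Suc.prems(2)] .
  qed
qed

lemma Pr_sums_first_hit_at:
  assumes [measurable]: "Measurable.pred path_space \<phi>"
  shows "(\<lambda>t. Pr m (\<lambda>\<omega>. \<phi> \<omega> \<and> first_hit_at n t \<omega>)) sums Pr m (\<lambda>\<omega>. \<phi> \<omega> \<and> ev (\<lambda>\<omega>. shd \<omega> = n) \<omega>)"
proof -
  interpret prob_space "Q m" by (rule prob_space_Q)
  have "(\<lambda>t. prob {\<omega>. \<phi> \<omega> \<and> first_hit_at n t \<omega>}) sums prob (\<Union>t. {\<omega>. \<phi> \<omega> \<and> first_hit_at n t \<omega>})"
  proof (rule finite_measure_UNION)
    show "range (\<lambda>t. {\<omega>. \<phi> \<omega> \<and> first_hit_at n t \<omega>}) \<subseteq> events"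
      by (intro image_subsetI sets_Q_pred) measurable
    have "t = t'" if "first_hit_at n t \<omega>" "first_hit_at n t' \<omega>" for t t' \<omega>
      using that unfolding first_hit_at_def by (metis linorder_less_linear)
    then show "disjoint_family (\<lambda>t. {\<omega>. \<phi> \<omega> \<and> first_hit_at n t \<omega>})"
      unfolding disjoint_family_on_def by blast
  qed
  moreover have "(\<Union>t. {\<omega>. \<phi> \<omega> \<and> first_hit_at n t \<omega>}) = {\<omega>. \<phi> \<omega> \<and> ev (\<lambda>\<omega>. shd \<omega> = n) \<omega>}"
    unfolding ev_iff_first_hit_at by blast
  ultimately show ?thesis by (simp add: Pr_def)
qed

lemma Pr_hit_comparison:
  assumes "Measurable.pred path_space \<phi>" "Measurable.pred path_space \<psi>" "n \<le> m"
    and "\<And>w. set w \<subseteq> {n<..} \<Longrightarrow> hd (w @ [n]) = m \<Longrightarrow>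
      c * Pr n (\<lambda>\<omega>. \<phi> (w @- \<omega>)) \<le> Pr n (\<lambda>\<omega>. \<psi> (w @- \<omega>))"
  shows "c * Pr m (\<lambda>\<omega>. \<phi> \<omega> \<and> ev (\<lambda>\<omega>. shd \<omega> = n) \<omega>) \<le> Pr m (\<lambda>\<omega>. \<psi> \<omega> \<and> ev (\<lambda>\<omega>. shd \<omega> = n) \<omega>)"
  using Pr_first_hit_at_comparison[OF assms]
  by (rule sums_le[OF _ sums_mult[OF Pr_sums_first_hit_at[OF assms(1)]] Pr_sums_first_hit_at[OF assms(2)]])

end

text \<open>Equality of heads is included to make the relation stable under prepending: whether a
  new letter creates an upcrossing depends on the letter after it.\<close>

definition same_ups :: "nat \<Rightarrow> nat stream \<Rightarrow> nat stream \<Rightarrow> bool" where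
  "same_ups x \<omega> \<omega>' \<longleftrightarrow> shd \<omega> = shd \<omega>' \<and> (finite (ups x \<omega>) \<longleftrightarrow> finite (ups x \<omega>')) \<and>
    (finite (ups x \<omega>) \<longrightarrow> card (ups x \<omega>) = card (ups x \<omega>'))"

lemma same_ups_shift: "same_ups x \<omega> \<omega>' \<Longrightarrow> same_ups x (u @- \<omega>) (u @- \<omega>')"
  by (induction u) (auto simp: same_ups_def card_ups_Stream)

lemma same_ups_has_ups: "same_ups x \<omega> \<omega>' \<Longrightarrow> has_ups a x \<omega> \<longleftrightarrow> has_ups a x \<omega>'"
  by (auto simp: same_ups_def has_ups_def)

lemma alw_HLD_shift: "set w \<subseteq> A \<Longrightarrow> alw (HLD A) (w @- \<omega>) \<longleftrightarrow> alw (HLD A) \<omega>"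
  by (induction w) (auto simp: alw_HLD_iff_streams streams_Stream)

context bd_laws
begin

lemma last_site_same_ups:
  assumes "\<And>x. n \<le> x \<Longrightarrow> same_ups x \<omega> \<omega>'"
  shows "last_site (has_ups a) N n (u @- \<omega>) \<longleftrightarrow> last_site (has_ups a) N n (u @- \<omega>')"
proof -
  have "has_ups a x (u @- \<omega>) \<longleftrightarrow> has_ups a x (u @- \<omega>')" if "n \<le> x" for x
    by (rule same_ups_has_ups[OF same_ups_shift[OF assms[OF that]]])
  then show ?thesis by (auto simp: last_site_def)
qed

text \<open>Excursions of the path below \<open>n\<close> do not affect the upcrossing numbers at sites \<open>\<ge> n\<close>.\<close>

lemma Pr_last_site_has_ups_up:
  assumes "1 \<le> n"
  shows "Pr n (\<lambda>\<omega>. last_site (has_ups a) N n (u @- \<omega>))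
    = Pr (Suc n) (\<lambda>\<omega>. last_site (has_ups a) N n (u @- (n ## \<omega>)))"
proof -
  let ?L = "last_site (has_ups a) N n"
  let ?g = "\<lambda>\<omega>. ?L (u @- (n ## \<omega>))"
  have L [measurable]: "Measurable.pred path_space (\<lambda>\<omega>. ?L (v @- \<omega>))" for v
    by (rule pred_shift) measurable
  have g [measurable]: "Measurable.pred path_space ?g"
    using L[of "u @ [n]"] by simp
  \<comment> \<open>Inserting a site \<open>m < n\<close> between \<open>n\<close> and a site at
    most \<open>n\<close> neither creates nor destroys an upcrossing at a site from \<open>n\<close>
    on.\<close>
  have skip: "?g (m ## \<omega>) \<longleftrightarrow> ?g \<omega>" if "m < n" "shd \<omega> \<le> n" for m \<omega>
    by (rule last_site_same_ups) (use that in \<open>auto simp: same_ups_def card_ups_Stream\<close>)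
  have "Pr m ?g = p m * Pr (Suc m) ?g + (1 - p m) * Pr (m - 1) ?g" if "m < n" for m
  proof -
    have "Pr k (\<lambda>\<omega>. ?g (m ## \<omega>)) = Pr k ?g" if "k \<le> n" for k
      by (rule Pr_start_cong, measurable) (use that \<open>m < n\<close> in \<open>simp only: skip\<close>)
    then show ?thesis using that by (subst Pr_step[OF g]) simp
  qed
  then have "Pr (n - 1) ?g = Pr n ?g" by (rule harmonic_const[of n "\<lambda>m. Pr m ?g"]) auto
  also have "\<dots> = Pr n (\<lambda>\<omega>. ?L (u @- \<omega>))"
  proof (rule Pr_start_cong[OF g L])
    fix \<omega> :: "nat stream" assume "shd \<omega> = n"
    then show "?g \<omega> \<longleftrightarrow> ?L (u @- \<omega>)"
      by (intro last_site_same_ups) (auto simp: same_ups_def card_ups_Stream)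
  qed
  finally have eq: "Pr (n - 1) ?g = Pr n (\<lambda>\<omega>. ?L (u @- \<omega>))" .
  have "Pr n (\<lambda>\<omega>. ?L (u @- \<omega>)) = p n * Pr (Suc n) ?g + (1 - p n) * Pr (n - 1) ?g"
    by (rule Pr_step[OF L])
  \<comment> \<open>The downward term is \<open>1 - p n\<close> times the unknown probability
    itself, so it cancels and leaves the upward term alone.\<close>
  then have "p n * Pr n (\<lambda>\<omega>. ?L (u @- \<omega>)) = p n * Pr (Suc n) ?g"
    unfolding eq by (simp add: algebra_simps)
  then show ?thesis using p_pos[of n] by simp
qed

text \<open>Induction on a bound \<open>d\<close> for the upcrossings of \<open>n\<close> still to
  come. The first step is taken upwards at cost \<open>p n\<close>. If the path comes back to
  \<open>n\<close>, one upcrossing is used up and the induction hypothesis applies from there; if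
  not, it has stayed above \<open>n\<close> already. The prefix \<open>u\<close> records the past,
  because the type of a site refers to the whole path.\<close>

lemma Pr_last_site_has_ups_above:
  assumes "1 \<le> n"
    and "\<And>\<omega>. shd \<omega> = n \<Longrightarrow> last_site (has_ups a) N n (u @- \<omega>) \<Longrightarrow> card (ups n \<omega>) \<le> d"
  shows "p n ^ d * Pr n (\<lambda>\<omega>. last_site (has_ups a) N n (u @- \<omega>))
    \<le> Pr n (\<lambda>\<omega>. last_site (has_ups a) N n (u @- \<omega>) \<and> alw (HLD {n..}) \<omega>)"
  using assms(2)
proof (induction d arbitrary: u)
  case 0
  let ?L = "last_site (has_ups a) N n"
  have L [measurable]: "Measurable.pred path_space (\<lambda>\<omega>. ?L (v @- \<omega>))" for v
    by (rule pred_shift) measurable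
  have g [measurable]: "Measurable.pred path_space (\<lambda>\<omega>. ?L (u @- (n ## \<omega>)))"
    using L[of "u @ [n]"] by simp
  \<comment> \<open>An upward step is itself an upcrossing, against the bound 0; so the event has
    probability 0 and there is nothing to prove.\<close>
  have "Pr (Suc n) (\<lambda>\<omega>. ?L (u @- (n ## \<omega>))) = Pr (Suc n) (\<lambda>_. False)"
  proof (rule Pr_start_cong[OF g])
    fix \<omega> :: "nat stream" assume \<omega>: "shd \<omega> = Suc n"
    have "\<not> ?L (u @- (n ## \<omega>))"
    proof
      assume L': "?L (u @- (n ## \<omega>))"
      then have "finite (ups n \<omega>)" by (simp add: last_site_def has_ups_def)
      then show False using 0[OF _ L'] \<omega> by (simp add: card_ups_Stream)
    qed
    then show "?L (u @- (n ## \<omega>)) \<longleftrightarrow> False" by simp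
  qed simp
  then show ?case using Pr_last_site_has_ups_up[OF assms(1)] by (simp add: Pr_False Pr_nonneg)
next
  case (Suc d)
  let ?L = "last_site (has_ups a) N n" and ?H = "ev (\<lambda>\<omega>. shd \<omega> = n)" and ?N = "alw (HLD {n..})"
  let ?g = "\<lambda>\<omega>. ?L (u @- (n ## \<omega>))"
  have L [measurable]: "Measurable.pred path_space (\<lambda>\<omega>. ?L (v @- \<omega>))" for v
    by (rule pred_shift) measurable
  have g [measurable]: "Measurable.pred path_space ?g"
    using L[of "u @ [n]"] by simp
  have gN: "Measurable.pred path_space (\<lambda>\<omega>. ?g \<omega> \<and> ?N \<omega>)"
    by (intro pred_intros_logic g) measurable
  have hit: "p n ^ d * Pr (Suc n) (\<lambda>\<omega>. ?g \<omega> \<and> ?H \<omega>) \<le> Pr (Suc n) (\<lambda>\<omega>. (?g \<omega> \<and> ?N \<omega>) \<and> ?H \<omega>)"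
  proof (rule Pr_hit_comparison[OF g gN])
    fix w assume w: "set w \<subseteq> {n<..}" "hd (w @ [n]) = Suc n"
    then obtain w' where w': "w = Suc n # w'" by (cases w) auto
    have "p n ^ d * Pr n (\<lambda>\<omega>. ?L ((u @ n # w) @- \<omega>)) \<le> Pr n (\<lambda>\<omega>. ?L ((u @ n # w) @- \<omega>) \<and> ?N \<omega>)"
    proof (rule Suc.IH)
      fix \<omega> :: "nat stream" assume L': "?L ((u @ n # w) @- \<omega>)"
      then have fin: "finite (ups n \<omega>)" unfolding last_site_def has_ups_def finite_ups_shift by blast
      \<comment> \<open>The step from \<open>n\<close> to the head \<open>Suc n\<close> of
        \<open>w\<close> is one of the upcrossings counted here, which leaves at most
        \<open>d\<close> for the rest.\<close>
      have "card (ups n (n ## (w @- \<omega>))) \<le> Suc d"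
        using Suc.prems[of "n ## (w @- \<omega>)"] L' by simp
      then have "card (ups n (w @- \<omega>)) \<le> d"
        using fin by (simp add: card_ups_Stream w')
      then show "card (ups n \<omega>) \<le> d" using card_ups_shift_ge[OF fin, of w] by simp
    qed
    moreover have "?N (w @- \<omega>) \<longleftrightarrow> ?N \<omega>" for \<omega>
      by (rule alw_HLD_shift) (use w in force)
    ultimately show "p n ^ d * Pr n (\<lambda>\<omega>. ?g (w @- \<omega>)) \<le> Pr n (\<lambda>\<omega>. ?g (w @- \<omega>) \<and> ?N (w @- \<omega>))"
      by simp
  qed simp
  have "p n ^ d * Pr (Suc n) (\<lambda>\<omega>. ?g \<omega> \<and> \<not> ?H \<omega>) \<le> 1 * Pr (Suc n) (\<lambda>\<omega>. ?g \<omega> \<and> \<not> ?H \<omega>)"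
    by (intro mult_right_mono power_le_one Pr_nonneg p_le_1) (simp add: p_pos less_imp_le)
  also have "\<dots> \<le> Pr (Suc n) (\<lambda>\<omega>. (?g \<omega> \<and> ?N \<omega>) \<and> \<not> ?H \<omega>)"
    unfolding mult_1
  proof (rule Pr_le_AE)
    show "AE \<omega> in Q (Suc n). ?g \<omega> \<and> \<not> ?H \<omega> \<longrightarrow> (?g \<omega> \<and> ?N \<omega>) \<and> \<not> ?H \<omega>"
      using AE_stays_above[of n] by eventually_elim (simp add: not_ev_iff)
    show "Measurable.pred path_space (\<lambda>\<omega>. (?g \<omega> \<and> ?N \<omega>) \<and> \<not> ?H \<omega>)"
      by (intro pred_intros_logic gN) measurable
  qed
  finally have "p n ^ d * Pr (Suc n) ?g \<le> Pr (Suc n) (\<lambda>\<omega>. ?g \<omega> \<and> ?N \<omega>)"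
    using hit Pr_split[OF g, of ?H "Suc n"] Pr_split[OF gN, of ?H "Suc n"]
    by (simp add: distrib_left)
  then have "p n * (p n ^ d * Pr (Suc n) ?g) \<le> p n * Pr (Suc n) (\<lambda>\<omega>. ?g \<omega> \<and> ?N \<omega>)"
    using p_pos[of n] by simp
  also have "\<dots> \<le> Pr n (\<lambda>\<omega>. ?L (u @- \<omega>) \<and> ?N \<omega>)"
  proof -
    have N: "?N (n ## \<omega>) \<longleftrightarrow> ?N \<omega>" for \<omega> using alw_HLD_shift[of "[n]" "{n..}" \<omega>] by simp
    have "Pr n (\<lambda>\<omega>. ?L (u @- \<omega>) \<and> ?N \<omega>)
        = p n * Pr (Suc n) (\<lambda>\<omega>. ?g \<omega> \<and> ?N \<omega>) + (1 - p n) * Pr (n - 1) (\<lambda>\<omega>. ?g \<omega> \<and> ?N \<omega>)"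
      by (subst Pr_step, intro pred_intros_logic L, measurable) (simp only: N)
    then show ?thesis using p_le_1[of n] Pr_nonneg by simp
  qed
  finally show ?case using Pr_last_site_has_ups_up[OF assms(1)] by (simp add: mult_ac)
qed

section \<open>Weak cutpoints in the block argument\<close>

lemma weak_cut_prefix:
  assumes "m < n" shows "weak_cut n (m ## \<omega>) \<longleftrightarrow> weak_cut n \<omega>"
proof
  assume "weak_cut n (m ## \<omega>)"
  then obtain k where k: "(m ## \<omega>) !! k = n" "\<And>i. i < k \<Longrightarrow> (m ## \<omega>) !! i \<in> {..n}"
    "\<And>i. k < i \<Longrightarrow> (m ## \<omega>) !! i \<in> {n..}"
    unfolding weak_cut_def by blast
  then obtain j where "k = Suc j" using assms by (cases k) auto
  then show "weak_cut n \<omega>"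
    unfolding weak_cut_def using k(1) k(2)[of "Suc _"] k(3)[of "Suc _"] by (intro exI[of _ j]) auto
next
  assume "weak_cut n \<omega>"
  then obtain k where k: "\<omega> !! k = n" "\<And>i. i < k \<Longrightarrow> \<omega> !! i \<in> {..n}" "\<And>i. k < i \<Longrightarrow> \<omega> !! i \<in> {n..}"
    unfolding weak_cut_def by blast
  have "(m ## \<omega>) !! i \<in> {..n}" if "i < Suc k" for i using that k(2) assms by (cases i) auto
  moreover have "(m ## \<omega>) !! i \<in> {n..}" if "Suc k < i" for i using that k(3) by (cases i) auto
  ultimately show "weak_cut n (m ## \<omega>)"
    unfolding weak_cut_def using k(1) by (intro exI[of _ "Suc k"]) auto
qed

text \<open>Either time 0 is the cut time, and the rest stays at or above \<open>n\<close>, or a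
  later time is, and a leading \<open>n\<close> violates no condition.\<close>

lemma weak_cut_self:
  "weak_cut n (n ## \<omega>) \<longleftrightarrow> alw (HLD {n..}) \<omega> \<or> weak_cut n \<omega>"
proof
  assume "weak_cut n (n ## \<omega>)"
  then obtain k where k: "(n ## \<omega>) !! k = n" "\<And>i. i < k \<Longrightarrow> (n ## \<omega>) !! i \<in> {..n}"
    "\<And>i. k < i \<Longrightarrow> (n ## \<omega>) !! i \<in> {n..}"
    unfolding weak_cut_def by blast
  show "alw (HLD {n..}) \<omega> \<or> weak_cut n \<omega>"
  proof (cases k)
    case 0
    then have "\<omega> !! i \<in> {n..}" for i using k(3)[of "Suc i"] by simp
    then show ?thesis by (simp add: alw_iff_sdrop HLD_iff)
  next
    case (Suc j)
    have "weak_cut n \<omega>"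
      unfolding weak_cut_def using Suc k(1) k(2)[of "Suc _"] k(3)[of "Suc _"] by (intro exI[of _ j]) auto
    then show ?thesis ..
  qed
next
  assume "alw (HLD {n..}) \<omega> \<or> weak_cut n \<omega>"
  then show "weak_cut n (n ## \<omega>)"
  proof
    assume "alw (HLD {n..}) \<omega>"
    then have *: "\<omega> !! i \<in> {n..}" for i by (simp add: alw_iff_sdrop HLD_iff)
    have "(n ## \<omega>) !! i \<in> {n..}" if "0 < i" for i using that * by (cases i) auto
    then show ?thesis unfolding weak_cut_def by (intro exI[of _ 0]) auto
  next
    assume "weak_cut n \<omega>"
    then obtain k where k: "\<omega> !! k = n" "\<And>i. i < k \<Longrightarrow> \<omega> !! i \<in> {..n}" "\<And>i. k < i \<Longrightarrow> \<omega> !! i \<in> {n..}"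
      unfolding weak_cut_def by blast
    have "(n ## \<omega>) !! i \<in> {..n}" if "i < Suc k" for i using that k(2) by (cases i) auto
    moreover have "(n ## \<omega>) !! i \<in> {n..}" if "Suc k < i" for i using that k(3) by (cases i) auto
    ultimately show ?thesis
      unfolding weak_cut_def using k(1) by (intro exI[of _ "Suc k"]) auto
  qed
qed

text \<open>A first step down leaves the event unchanged, so by prefix invariance its term cancels
  as for upcrossing numbers. After a first step up, time 0 must be the cut time, since any later one
  would have \<open>n + 1\<close> in its past; hence the path stays at or above
  \<open>n\<close>.\<close>

lemma Pr_last_site_weak_cut_above:
  assumes "1 \<le> n"
  shows "p n * Pr n (last_site weak_cut N n) \<le> Pr n (\<lambda>\<omega>. last_site weak_cut N n \<omega> \<and> alw (HLD {n..}) \<omega>)"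
proof -
  let ?L = "last_site weak_cut N n" and ?N = "alw (HLD {n..})"
  have pre: "?L (m ## \<omega>) \<longleftrightarrow> ?L \<omega>" if "m < n" for m \<omega>
    using that by (auto simp: last_site_def weak_cut_prefix)
  have const: "Pr (n - 1) ?L = Pr n ?L"
    by (rule Pr_eq_of_prefix_invariant, measurable) (auto simp: pre)
  have "Pr (n - 1) (\<lambda>\<omega>. ?L (n ## \<omega>)) = Pr (n - 1) ?L"
  proof (rule Pr_start_cong, measurable)
    fix \<omega> :: "nat stream" assume "shd \<omega> = n - 1"
    then have "\<not> ?N \<omega>" using assms by (auto simp: alw.simps[of _ \<omega>] HLD_iff)
    then show "?L (n ## \<omega>) \<longleftrightarrow> ?L \<omega>" by (auto simp: last_site_def weak_cut_prefix weak_cut_self)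
  qed
  moreover have "Pr n ?L = p n * Pr (Suc n) (\<lambda>\<omega>. ?L (n ## \<omega>)) + (1 - p n) * Pr (n - 1) (\<lambda>\<omega>. ?L (n ## \<omega>))"
    by (rule Pr_step) measurable
  ultimately have "Pr n ?L = p n * Pr (Suc n) (\<lambda>\<omega>. ?L (n ## \<omega>)) + (1 - p n) * Pr n ?L"
    using const by simp
  then have "p n * Pr n ?L = p n * Pr (Suc n) (\<lambda>\<omega>. ?L (n ## \<omega>))" by (simp add: algebra_simps)
  also have "Pr (Suc n) (\<lambda>\<omega>. ?L (n ## \<omega>)) \<le> Pr (Suc n) (\<lambda>\<omega>. ?L (n ## \<omega>) \<and> ?N \<omega>)"
  proof (rule Pr_start_mono, measurable)
    fix \<omega> :: "nat stream" assume \<omega>: "shd \<omega> = Suc n" "?L (n ## \<omega>)"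
    then obtain k where k: "(n ## \<omega>) !! k = n" "\<And>i. i < k \<Longrightarrow> (n ## \<omega>) !! i \<in> {..n}"
      "\<And>i. k < i \<Longrightarrow> (n ## \<omega>) !! i \<in> {n..}"
      unfolding last_site_def weak_cut_def by blast
    have "k = 0"
    proof (rule ccontr)
      assume "k \<noteq> 0"
      moreover have "k \<noteq> 1" using k(1) \<omega>(1) by auto
      ultimately show False using k(2)[of 1] \<omega>(1) by simp
    qed
    then have "\<omega> !! i \<in> {n..}" for i using k(3)[of "Suc i"] by simp
    then show "?L (n ## \<omega>) \<and> ?N \<omega>" using \<omega>(2) by (simp add: alw_iff_sdrop HLD_iff)
  qed
  also have "p n * Pr (Suc n) (\<lambda>\<omega>. ?L (n ## \<omega>) \<and> ?N \<omega>) \<le> Pr n (\<lambda>\<omega>. ?L \<omega> \<and> ?N \<omega>)"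
  proof -
    have N: "?N (n ## \<omega>) \<longleftrightarrow> ?N \<omega>" for \<omega> using alw_HLD_shift[of "[n]" "{n..}" \<omega>] by simp
    have "Pr n (\<lambda>\<omega>. ?L \<omega> \<and> ?N \<omega>)
        = p n * Pr (Suc n) (\<lambda>\<omega>. ?L (n ## \<omega>) \<and> ?N \<omega>) + (1 - p n) * Pr (n - 1) (\<lambda>\<omega>. ?L (n ## \<omega>) \<and> ?N \<omega>)"
      by (subst Pr_step, measurable) (simp only: N)
    then show ?thesis using p_le_1[of n] Pr_nonneg by simp
  qed
  finally show ?thesis using p_pos[of n] by simp
qed

text \<open>From \<open>rho \<le> 1\<close> follows \<open>p n \<ge> 1 / 2\<close>. So
  \<open>c = (1/2) ^ a\<close> serves for sites with \<open>a\<close> upcrossings, one factor per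
  upcrossing, and \<open>c = 1/2\<close> for weak cutpoints.\<close>

theorem finitely_many_has_ups_and_weak_cut:
  assumes rho_le: "\<And>k. n1 \<le> k \<Longrightarrow> rho p k \<le> 1"
    and sum: "summable (\<lambda>n. escape (n + 2) / ln (real (n + 2)))"
  shows "AE \<omega> in Q 0. finite {n. has_ups a n \<omega>}" and "AE \<omega> in Q 0. finite {n. weak_cut n \<omega>}"
proof -
  have half: "1 / 2 \<le> p n" if "max 1 n1 \<le> n" for n
    by (rule p_ge_half) (use rho_le that in simp)
  show "AE \<omega> in Q 0. finite {n. has_ups a n \<omega>}"
  proof (rule finitely_many_sites[where c = "(1/2) ^ a" and ?n1.0 = "max 1 n1"])
    fix n N assume n: "max 1 n1 \<le> n"
    have "p n ^ a * Pr n (last_site (has_ups a) N n)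
        \<le> Pr n (\<lambda>\<omega>. last_site (has_ups a) N n \<omega> \<and> alw (HLD {n..}) \<omega>)"
    proof -
      have "card (ups n \<omega>) \<le> a" if "last_site (has_ups a) N n ([] @- \<omega>)" for \<omega>
        using that by (simp add: last_site_def has_ups_def)
      then show ?thesis using Pr_last_site_has_ups_above[of n a N "[]" a] n by simp
    qed
    moreover have "(1/2) ^ a * Pr n (last_site (has_ups a) N n) \<le> p n ^ a * Pr n (last_site (has_ups a) N n)"
      using half[OF n] by (intro mult_right_mono power_mono Pr_nonneg) auto
    ultimately show "(1/2) ^ a * Pr n (last_site (has_ups a) N n)
        \<le> Pr n (\<lambda>\<omega>. last_site (has_ups a) N n \<omega> \<and> alw (HLD {n..}) \<omega>)" by linarith
  qed (use rho_le sum in \<open>simp_all add: has_ups_prefix\<close>)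
  show "AE \<omega> in Q 0. finite {n. weak_cut n \<omega>}"
  proof (rule finitely_many_sites[where c = "1/2" and ?n1.0 = "max 1 n1"])
    fix n N assume n: "max 1 n1 \<le> n"
    have "1/2 * Pr n (last_site weak_cut N n) \<le> p n * Pr n (last_site weak_cut N n)"
      using half[OF n] by (intro mult_right_mono Pr_nonneg) auto
    then show "1/2 * Pr n (last_site weak_cut N n)
        \<le> Pr n (\<lambda>\<omega>. last_site weak_cut N n \<omega> \<and> alw (HLD {n..}) \<omega>)"
      using Pr_last_site_weak_cut_above[of n N] n by linarith
  qed (use rho_le sum in \<open>simp_all add: weak_cut_prefix\<close>)
qed

end

section \<open>Infinitely many sites: the second moment argument\<close>

text \<open>A weighted form of the Kochen--Stone lemma; the weights replace passing to a sparse subsequence.\<close>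

lemma (in prob_space) prob_infinitely_often_nonzero:
  fixes \<theta> :: "nat \<Rightarrow> real" and m :: "nat \<Rightarrow> real"
  assumes A [measurable]: "\<And>n. A n \<in> events"
    and \<theta>: "\<And>n. 0 \<le> \<theta> n"
    and m_def: "\<And>K. m K = (\<Sum>x<K. \<theta> x * prob (A x))"
    and div: "\<not> summable (\<lambda>n. \<theta> n * prob (A n))"
    and C: "0 < C"
    and second: "\<And>K. 1 \<le> m K \<Longrightarrow> (\<Sum>x<K. \<Sum>y<K. \<theta> x * \<theta> y * prob (A x \<inter> A y)) \<le> C * (m K)\<^sup>2"
  shows "prob {\<omega>\<in>space M. infinite {n. \<omega> \<in> A n}} \<noteq> 0"
proof
  assume null: "prob {\<omega>\<in>space M. infinite {n. \<omega> \<in> A n}} = 0"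
  define B where "B r = (\<Union>n\<in>{r..}. A n)" for r :: nat
  have B [measurable]: "B r \<in> events" for r unfolding B_def by measurable
  have "(\<Inter>r. B r) = {\<omega>\<in>space M. infinite {n. \<omega> \<in> A n}}"
    using sets.sets_into_space[OF A] unfolding B_def infinite_nat_iff_unbounded_le by blast
  moreover have "(\<lambda>r. prob (B r)) \<longlonglongrightarrow> prob (\<Inter>r. B r)"
  proof (rule finite_Lim_measure_decseq)
    show "range B \<subseteq> events" using B by blast
    show "decseq B" unfolding decseq_def B_def by (intro allI impI UN_mono) auto
  qed
  ultimately have "(\<lambda>r. prob (B r)) \<longlonglongrightarrow> 0" using null by simp
  then have "\<forall>\<^sub>F r in sequentially. prob (B r) < 1 / (4 * C)"
    by (rule order_tendstoD) (use C in simp)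
  then obtain r where r: "prob (B r) < 1 / (4 * C)" using eventually_happens by force
  define R where "R = (\<Sum>x<r. \<theta> x)"
  have bound: "m K \<le> 2 * R" if K: "1 \<le> m K" for K
  proof -
    define N where "N \<omega> = (\<Sum>x<K. \<theta> x * indicator (A x) \<omega>)" for \<omega>
    \<comment> \<open>With this choice both \<open>C * (m K)\<^sup>2 / (2 * t)\<close> and
      \<open>t / 2 * (1 / (4 * C))\<close> equal \<open>m K / 4\<close>, so the estimate becomes
      \<open>m K \<le> R + m K / 2\<close>.\<close>
    define t where "t = 2 * C * m K"
    have t: "0 < t" using C K by (simp add: t_def)
    have N_sq: "(N \<omega>)\<^sup>2 = (\<Sum>x<K. \<Sum>y<K. \<theta> x * \<theta> y * indicator (A x \<inter> A y) \<omega>)" for \<omega>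
      unfolding N_def power2_eq_square sum_product indicator_inter_arith by (simp only: mult_ac)
    have int_ind: "integrable M (\<lambda>\<omega>. c * indicator S \<omega> :: real)" if "S \<in> events" for c S
      using that by (intro integrable_mult_right integrable_real_indicator) (auto simp: emeasure_eq_measure)
    have exp_ind: "expectation (\<lambda>\<omega>. c * indicator S \<omega>) = c * prob S" if "S \<in> events" for c S
      using that sets.sets_into_space[OF that] by (simp add: Int_absorb2)
    have int_N: "integrable M N"
      unfolding N_def by (intro Bochner_Integration.integrable_sum int_ind A)
    have int_N2: "integrable M (\<lambda>\<omega>. (N \<omega>)\<^sup>2)"
      unfolding N_sq by (intro Bochner_Integration.integrable_sum int_ind sets.Int A)
    have exp_N: "expectation N = m K"
      unfolding N_def m_def
      by (subst Bochner_Integration.integral_sum) (intro int_ind A, simp only: exp_ind A)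
    have "expectation (\<lambda>\<omega>. (N \<omega>)\<^sup>2) = (\<Sum>x<K. \<Sum>y<K. \<theta> x * \<theta> y * prob (A x \<inter> A y))"
      unfolding N_sq
      by (subst Bochner_Integration.integral_sum, intro Bochner_Integration.integrable_sum int_ind sets.Int A,
          intro sum.cong refl, subst Bochner_Integration.integral_sum, intro int_ind sets.Int A)
         (simp only: exp_ind sets.Int A)
    then have exp_N2: "expectation (\<lambda>\<omega>. (N \<omega>)\<^sup>2) \<le> C * (m K)\<^sup>2" using second[OF K] by simp
    \<comment> \<open>On \<open>B r\<close> this is the inequality between arithmetic and geometric
      mean; off \<open>B r\<close> only events with index below \<open>r\<close> can occur, and
      their total weight is at most \<open>R\<close>.\<close>
    have "N \<omega> \<le> R + ((N \<omega>)\<^sup>2 / (2 * t) + t / 2 * indicator (B r) \<omega>)" for \<omega>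
    proof (cases "\<omega> \<in> B r")
      case True
      have "0 \<le> (N \<omega> - t)\<^sup>2" by simp
      then have "2 * t * N \<omega> \<le> (N \<omega>)\<^sup>2 + t\<^sup>2" by (simp add: power2_diff mult_ac)
      then have "N \<omega> \<le> ((N \<omega>)\<^sup>2 + t\<^sup>2) / (2 * t)" using t by (simp add: field_simps)
      also have "\<dots> = (N \<omega>)\<^sup>2 / (2 * t) + t / 2" using t by (simp add: field_simps power2_eq_square)
      finally have "N \<omega> \<le> (N \<omega>)\<^sup>2 / (2 * t) + t / 2" .
      moreover have "0 \<le> R" by (simp add: R_def sum_nonneg \<theta>)
      ultimately show ?thesis using True by simp
    next
      case False
      have "N \<omega> \<le> (\<Sum>x<K. if x < r then \<theta> x else 0)"
        unfolding N_def using False \<theta> by (intro sum_mono) (auto simp: B_def indicator_def)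
      also have "\<dots> = (\<Sum>x\<in>{..<K} \<inter> {..<r}. \<theta> x)"
        by (simp add: sum.inter_restrict)
      also have "\<dots> \<le> R" unfolding R_def by (rule sum_mono2) (auto simp: \<theta>)
      finally show ?thesis using t False by (simp add: add_increasing2)
    qed
    then have le: "N \<omega> \<le> R + ((N \<omega>)\<^sup>2 / (2 * t) + t / 2 * indicator (B r) \<omega>)" for \<omega> .
    have iB: "integrable M (\<lambda>\<omega>. t / 2 * indicator (B r) \<omega>)" by (rule int_ind[OF B])
    have iD: "integrable M (\<lambda>\<omega>. (N \<omega>)\<^sup>2 / (2 * t))" by (simp add: int_N2)
    have iS: "integrable M (\<lambda>\<omega>. (N \<omega>)\<^sup>2 / (2 * t) + t / 2 * indicator (B r) \<omega>)"
      by (rule Bochner_Integration.integrable_add[OF iD iB])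
    have "expectation N \<le> expectation (\<lambda>\<omega>. R + ((N \<omega>)\<^sup>2 / (2 * t) + t / 2 * indicator (B r) \<omega>))"
      by (rule integral_mono[OF int_N Bochner_Integration.integrable_add[OF integrable_const iS] le])
    also have "\<dots> = expectation (\<lambda>_. R) + (expectation (\<lambda>\<omega>. (N \<omega>)\<^sup>2 / (2 * t))
        + expectation (\<lambda>\<omega>. t / 2 * indicator (B r) \<omega>))"
      by (simp only: Bochner_Integration.integral_add[OF integrable_const iS] Bochner_Integration.integral_add[OF iD iB])
    also have "\<dots> = R + (expectation (\<lambda>\<omega>. (N \<omega>)\<^sup>2) / (2 * t) + t / 2 * prob (B r))"
      unfolding exp_ind[OF B] by (simp add: prob_space)
    also have "\<dots> \<le> R + (C * (m K)\<^sup>2 / (2 * t) + t / 2 * (1 / (4 * C)))"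
      using exp_N2 t r by (intro add_mono divide_right_mono mult_left_mono order_refl) auto
    also have "\<dots> = R + m K / 2"
      using C K by (simp add: t_def power2_eq_square field_simps)
    finally show ?thesis using exp_N by simp
  qed
  have "summable (\<lambda>n. \<theta> n * prob (A n))"
  proof (rule summableI_nonneg_bounded)
    show "0 \<le> \<theta> n * prob (A n)" for n by (simp add: \<theta>)
    show "(\<Sum>x<K. \<theta> x * prob (A x)) \<le> max 1 (2 * R)" for K
      using bound[of K] unfolding m_def[symmetric] by (cases "1 \<le> m K") auto
  qed
  then show False using div by simp
qed

lemma sum_symmetric:
  fixes a :: "nat \<Rightarrow> nat \<Rightarrow> real"
  assumes sym: "\<And>x y. a x y = a y x"
  shows "(\<Sum>x<K. \<Sum>y<K. a x y) = (\<Sum>x<K. a x x + 2 * (\<Sum>y\<in>{x<..<K}. a x y))"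
proof -
  have "(\<Sum>y<K. a x y) = a x x + (\<Sum>y\<in>{x<..<K}. a x y) + (\<Sum>y\<in>{..<x}. a x y)" if "x < K" for x
  proof -
    have "{..<K} = insert x ({x<..<K} \<union> {..<x})" using that by auto
    moreover have "sum (a x) ({x<..<K} \<union> {..<x}) = sum (a x) {x<..<K} + sum (a x) {..<x}"
      by (rule sum.union_disjoint) auto
    ultimately show ?thesis by simp
  qed
  then have "(\<Sum>x<K. \<Sum>y<K. a x y)
      = (\<Sum>x<K. a x x) + (\<Sum>x<K. \<Sum>y\<in>{x<..<K}. a x y) + (\<Sum>x<K. \<Sum>y\<in>{..<x}. a x y)"
    by (simp add: sum.distrib)
  also have "(\<Sum>x<K. \<Sum>y\<in>{..<x}. a x y) = (\<Sum>x<K. \<Sum>y\<in>{y. y \<in> {..<K} \<and> y < x}. a x y)"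
    by (intro sum.cong refl) auto
  also have "\<dots> = (\<Sum>y<K. \<Sum>x\<in>{x. x \<in> {..<K} \<and> y < x}. a x y)"
    by (rule sum.swap_restrict) auto
  also have "\<dots> = (\<Sum>y<K. \<Sum>x\<in>{y<..<K}. a y x)"
    by (intro sum.cong) (auto simp: sym)
  finally show ?thesis by (simp add: sum.distrib sum_distrib_left)
qed

section \<open>Sites with prescribed numbers of visits and upcrossings\<close>

definition site_type :: "nat \<Rightarrow> nat \<Rightarrow> nat \<Rightarrow> nat stream \<Rightarrow> bool" where
  "site_type a b x \<omega> \<longleftrightarrow> finite (visits x \<omega>) \<and> card (visits x \<omega>) = a \<and>
     finite (ups x \<omega>) \<and> card (ups x \<omega>) = b"

lemma site_type_measurable [measurable]: "Measurable.pred path_space (site_type a b x)"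
  unfolding site_type_def by measurable

lemma site_type_Stream: "m \<noteq> x \<Longrightarrow> site_type a b x (m ## \<omega>) \<longleftrightarrow> site_type a b x \<omega>"
  by (auto simp: site_type_def visits_Stream ups_Stream finite_image_iff card_image)

text \<open>Prepending \<open>m\<close> changes the counts at the single site \<open>m\<close> only.
  This is the shift invariance required by the zero-one law.\<close>

lemma infinite_site_type_Stream:
  "infinite {x. site_type a b x (m ## \<omega>)} \<longleftrightarrow> infinite {x. site_type a b x \<omega>}"
proof -
  have "{x. site_type a b x (m ## \<omega>)} - {m} = {x. site_type a b x \<omega>} - {m}"
    by (auto simp: site_type_Stream)
  moreover have "finite (S - {m}) \<longleftrightarrow> finite S" for S by simp
  ultimately show ?thesis by metis
qed

text \<open>\<open>pattern x ds\<close>: from \<open>x\<close>, make the two-step loops \<open>ds\<close> through \<open>x + 1\<close> (\<open>True\<close>) or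
  \<open>x - 1\<close> (\<open>False\<close>), then leave \<open>x\<close> upwards for good.\<close>

primrec pattern :: "nat \<Rightarrow> bool list \<Rightarrow> nat stream \<Rightarrow> bool" where
  "pattern x [] \<omega> \<longleftrightarrow> shd \<omega> = x \<and> shd (stl \<omega>) = Suc x \<and> alw (\<lambda>\<omega>. shd \<omega> \<noteq> x) (stl \<omega>)"
| "pattern x (d # ds) \<omega> \<longleftrightarrow> shd \<omega> = x \<and> shd (stl \<omega>) = (if d then Suc x else x - 1) \<and>
     pattern x ds (stl (stl \<omega>))"

lemma pattern_measurable [measurable]: "Measurable.pred path_space (pattern x ds)"
proof (induction ds)
  case Nil
  have "Measurable.pred path_space (\<lambda>\<omega>. pattern x [] \<omega>)" unfolding pattern.simps by measurable
  then show ?case by simp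
next
  case (Cons d ds)
  note [measurable] = Cons
  have "Measurable.pred path_space (\<lambda>\<omega>. pattern x (d # ds) \<omega>)" unfolding pattern.simps by measurable
  then show ?case by simp
qed

lemma pattern_start: "pattern x ds \<omega> \<Longrightarrow> shd \<omega> = x"
  by (cases ds) auto

text \<open>Each loop adds one visit, and one upcrossing if it goes up; the final departure adds one
  of each. \<open>1 \<le> x\<close> makes the truncated \<open>x - 1\<close> different from
  \<open>x\<close>.\<close>

lemma pattern_site_type:
  assumes "1 \<le> x"
  shows "pattern x ds \<omega> \<Longrightarrow> site_type (Suc (length ds)) (Suc (length (filter id ds))) x \<omega>"
proof (induction ds arbitrary: \<omega>)
  case Nil
  obtain \<omega>' where \<omega>: "\<omega> = x ## \<omega>'" "shd \<omega>' = Suc x" "alw (\<lambda>\<omega>. shd \<omega> \<noteq> x) \<omega>'"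
    using Nil by (cases \<omega>) auto
  have "\<omega>' !! k \<noteq> x" for k using \<omega>(3) by (simp add: alw_iff_sdrop)
  then have "visits x \<omega>' = {}" "ups x \<omega>' = {}" by (auto simp: visits_def ups_def)
  then show ?case using \<omega> by (simp add: site_type_def visits_Stream ups_Stream)
next
  case (Cons d ds)
  let ?y = "if d then Suc x else x - 1"
  define \<omega>' where "\<omega>' = stl (stl \<omega>)"
  have \<omega>: "\<omega> = x ## ?y ## \<omega>'" and p: "pattern x ds \<omega>'"
    using Cons.prems unfolding \<omega>'_def by (auto simp: stream_eq_Stream_iff)
  have "?y \<noteq> x" using assms by auto
  then show ?case using Cons.IH[OF p] assms pattern_start[OF p]
    unfolding \<omega> site_type_def
    by (auto simp: visits_Stream ups_Stream finite_image_iff card_image card_insert_if)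
qed

context bd_laws
begin

text \<open>The event \<open>E x\<close> of the overview. Starting the pattern at the first visit
  makes the count of visits exact and the event insensitive to steps below \<open>x\<close>.\<close>

definition pattern_at :: "bool list \<Rightarrow> nat \<Rightarrow> nat stream \<Rightarrow> bool" where
  "pattern_at ds x = first_hit x (pattern x ds)"

lemma pattern_at_measurable [measurable]: "Measurable.pred path_space (pattern_at ds x)"
  unfolding pattern_at_def by measurable

lemma pattern_at_Stream:
  "pattern_at ds x (m ## \<omega>) \<longleftrightarrow> (if m = x then pattern x ds (m ## \<omega>) else pattern_at ds x \<omega>)"
  by (simp add: pattern_at_def first_hit_SCons)

lemma pattern_at_site_type:
  assumes "1 \<le> x" and "pattern_at ds x \<omega>"
  shows "site_type (Suc (length ds)) (Suc (length (filter id ds))) x \<omega>"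
  using assms(2) unfolding pattern_at_def first_hit_def
proof (induction rule: suntil.induct)
  case (base \<omega>)
  then show ?case using pattern_site_type[OF assms(1)] by blast
next
  case (step \<omega>)
  then show ?case using site_type_Stream[of "shd \<omega>" x _ _ "stl \<omega>"] by simp
qed

text \<open>The probability, from \<open>x\<close>, of the loops \<open>ds\<close> followed by one
  step up; the probability of not returning is kept apart as \<open>escape x\<close>.\<close>

primrec pattern_weight :: "nat \<Rightarrow> bool list \<Rightarrow> real" where
  "pattern_weight x [] = p x"
| "pattern_weight x (d # ds) =
    (if d then p x * (1 - p (Suc x)) else (1 - p x) * p (x - 1)) * pattern_weight x ds"

lemma pattern_weight_nonneg: "0 \<le> pattern_weight x ds"
  by (induction ds) (auto simp: p_pos p_le_1 less_imp_le)

lemma pattern_weight_le_1: "pattern_weight x ds \<le> 1"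
proof (induction ds)
  case (Cons d ds)
  have "(if d then p x * (1 - p (Suc x)) else (1 - p x) * p (x - 1)) \<le> 1"
    using p_pos p_le_1 by (auto intro!: mult_le_one simp: less_imp_le)
  then show ?case unfolding pattern_weight.simps by (rule mult_le_one[OF _ pattern_weight_nonneg Cons])
qed (simp add: p_le_1)

text \<open>The bounds on \<open>rho\<close> give \<open>p \<ge> 1 / 2\<close> and
  \<open>1 - p = rho * p \<ge> 1 / 4\<close>, so each loop costs at least 1/8 and the last step
  1/2.\<close>

lemma pattern_weight_ge:
  assumes "\<And>k. n1 \<le> k \<Longrightarrow> 1 / 2 \<le> rho p k \<and> rho p k \<le> 1" and "n1 < x"
  shows "(1 / 8) ^ length ds * (1 / 2) \<le> pattern_weight x ds"
proof (induction ds)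
  case Nil
  then show ?case using p_ge_half[of x] assms by simp
next
  case (Cons d ds)
  have q: "1 / 4 \<le> 1 - p k" if "n1 \<le> k" for k
  proof -
    have "1 / 2 * p k \<le> 1 - p k" using assms(1)[OF that] p_pos[of k] by (simp add: rho_def pos_le_divide_eq)
    then show ?thesis using p_ge_half[of k] assms(1)[OF that] by linarith
  qed
  have h: "1 / 2 \<le> p k" if "n1 \<le> k" for k using p_ge_half assms(1)[OF that] by blast
  have "1 / 2 * (1 / 4) \<le> p x * (1 - p (Suc x))"
    using h[of x] q[of "Suc x"] assms(2) by (intro mult_mono) auto
  moreover have "1 / 4 * (1 / 2) \<le> (1 - p x) * p (x - 1)"
    using q[of x] h[of "x - 1"] assms(2) p_le_1[of x] by (intro mult_mono) auto
  ultimately have "1 / 8 \<le> (if d then p x * (1 - p (Suc x)) else (1 - p x) * p (x - 1))" by simp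
  then have "1 / 8 * ((1 / 8) ^ length ds * (1 / 2))
      \<le> (if d then p x * (1 - p (Suc x)) else (1 - p x) * p (x - 1)) * pattern_weight x ds"
    using Cons by (intro mult_mono) auto
  then show ?case by simp
qed

text \<open>Each loop is two applications of first-step conditioning. Loops reach
  \<open>x + 1\<close>, which is why \<open>L\<close> has to ignore steps at all sites up to
  \<open>Suc x\<close>.\<close>

lemma Pr_pattern_and:
  assumes [measurable]: "Measurable.pred path_space L"
    and inv: "\<And>m \<omega>. m \<le> Suc x \<Longrightarrow> L (m ## \<omega>) \<longleftrightarrow> L \<omega>"
    and "1 \<le> x"
  shows "Pr x (\<lambda>\<omega>. pattern x ds \<omega> \<and> L \<omega>)
    = pattern_weight x ds * Pr (Suc x) (\<lambda>\<omega>. alw (\<lambda>\<omega>. shd \<omega> \<noteq> x) \<omega> \<and> L \<omega>)"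
proof (induction ds)
  case Nil
  let ?E = "\<lambda>\<omega>. shd \<omega> = Suc x \<and> alw (\<lambda>\<omega>. shd \<omega> \<noteq> x) \<omega> \<and> L \<omega>"
  have "Pr x (\<lambda>\<omega>. pattern x [] \<omega> \<and> L \<omega>) = p x * Pr (Suc x) ?E + (1 - p x) * Pr (x - 1) ?E"
    by (subst Pr_step, measurable) (simp add: inv)
  also have "Pr (Suc x) ?E = Pr (Suc x) (\<lambda>\<omega>. alw (\<lambda>\<omega>. shd \<omega> \<noteq> x) \<omega> \<and> L \<omega>)"
    by (rule Pr_start) measurable
  also have "Pr (x - 1) ?E = Pr (x - 1) (\<lambda>_. False)"
    by (rule Pr_start_cong, measurable) auto
  finally show ?case by (simp add: Pr_False)
next
  case (Cons d ds)
  let ?P = "\<lambda>\<omega>. pattern x ds \<omega> \<and> L \<omega>"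
  have other: "Pr k ?P = 0" if "k \<noteq> x" for k
  proof -
    have "Pr k ?P = Pr k (\<lambda>_. False)"
      by (rule Pr_start_cong, measurable) (use that pattern_start in blast)
    then show ?thesis by (simp add: Pr_False)
  qed
  let ?E = "\<lambda>y \<omega>. shd \<omega> = y \<and> pattern x ds (stl \<omega>) \<and> L \<omega>"
  have E_other: "Pr k (?E y) = 0" if "k \<noteq> y" for k y
  proof -
    have "Pr k (?E y) = Pr k (\<lambda>_. False)"
      by (rule Pr_start_cong, measurable) (use that in auto)
    then show ?thesis by (simp add: Pr_False)
  qed
  have E_self: "Pr y (?E y) = p y * Pr (Suc y) ?P + (1 - p y) * Pr (y - 1) ?P" if "y \<le> Suc x" for y
    using that by (subst Pr_step, measurable) (simp add: inv)
  let ?y = "if d then Suc x else x - 1"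
  have step: "Pr x (\<lambda>\<omega>. pattern x (d # ds) \<omega> \<and> L \<omega>) = p x * Pr (Suc x) (?E ?y) + (1 - p x) * Pr (x - 1) (?E ?y)"
    by (subst Pr_step, measurable) (simp add: inv)
  show ?case
  proof (cases d)
    case True
    then have "Pr x (\<lambda>\<omega>. pattern x (d # ds) \<omega> \<and> L \<omega>) = p x * Pr (Suc x) (?E (Suc x))"
      using step E_other[of "x - 1" "Suc x"] by simp
    also have "Pr (Suc x) (?E (Suc x)) = (1 - p (Suc x)) * Pr x ?P"
      using E_self[of "Suc x"] other[of "Suc (Suc x)"] by simp
    finally show ?thesis using Cons True by simp
  next
    case False
    then have "Pr x (\<lambda>\<omega>. pattern x (d # ds) \<omega> \<and> L \<omega>) = (1 - p x) * Pr (x - 1) (?E (x - 1))"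
      using step E_other[of "Suc x" "x - 1"] by simp
    also have "Pr (x - 1) (?E (x - 1)) = p (x - 1) * Pr x ?P"
      using E_self[of "x - 1"] other[of "x - 1 - 1"] \<open>1 \<le> x\<close> by simp
    finally show ?thesis using Cons False by simp
  qed
qed

lemma Pr_pattern_at_and:
  assumes [measurable]: "Measurable.pred path_space L"
    and inv: "\<And>m \<omega>. m \<le> Suc x \<Longrightarrow> L (m ## \<omega>) \<longleftrightarrow> L \<omega>"
    and "1 \<le> x"
  shows "Pr 0 (\<lambda>\<omega>. pattern_at ds x \<omega> \<and> L \<omega>)
    = pattern_weight x ds * Pr (Suc x) (\<lambda>\<omega>. alw (\<lambda>\<omega>. shd \<omega> \<noteq> x) \<omega> \<and> L \<omega>)"
proof -
  have "Pr 0 (\<lambda>\<omega>. pattern_at ds x \<omega> \<and> L \<omega>) = Pr x (\<lambda>\<omega>. pattern_at ds x \<omega> \<and> L \<omega>)"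
    by (rule Pr_eq_of_prefix_invariant, measurable) (simp_all add: pattern_at_Stream inv)
  also have "\<dots> = Pr x (\<lambda>\<omega>. pattern x ds \<omega> \<and> L \<omega>)"
  proof (rule Pr_start_cong, measurable)
    fix \<omega> :: "nat stream" assume "shd \<omega> = x"
    then have "pattern_at ds x \<omega> \<longleftrightarrow> pattern x ds \<omega>"
      by (cases \<omega>) (simp add: pattern_at_Stream)
    then show "pattern_at ds x \<omega> \<and> L \<omega> \<longleftrightarrow> pattern x ds \<omega> \<and> L \<omega>" by blast
  qed
  also note Pr_pattern_and[OF assms]
  finally show ?thesis .
qed

lemma Pr_pattern_at: "1 \<le> x \<Longrightarrow> Pr 0 (pattern_at ds x) = pattern_weight x ds * escape x"
  using Pr_pattern_at_and[of "\<lambda>_. True" x ds] by (simp add: escape_def)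

text \<open>After the pattern at \<open>x\<close> the path has to reach \<open>y\<close> from
  \<open>x + 1\<close> before returning to \<open>x\<close>, a factor
  \<open>1 / scale p x y\<close>; the condition of avoiding \<open>x\<close> after that is dropped.
  \<open>Suc x < y\<close> keeps the loops at \<open>x\<close> away from \<open>y\<close>.\<close>

lemma Pr_pattern_at_pair:
  assumes "1 \<le> x" "Suc x < y"
  shows "Pr 0 (\<lambda>\<omega>. pattern_at ds x \<omega> \<and> pattern_at ds y \<omega>)
    \<le> pattern_weight x ds * (Pr 0 (pattern_at ds y) / scale p x y)"
proof -
  have "Pr 0 (\<lambda>\<omega>. pattern_at ds x \<omega> \<and> pattern_at ds y \<omega>)
      = pattern_weight x ds * Pr (Suc x) (\<lambda>\<omega>. alw (\<lambda>\<omega>. shd \<omega> \<noteq> x) \<omega> \<and> pattern_at ds y \<omega>)"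
    by (rule Pr_pattern_at_and, measurable) (use assms in \<open>auto simp: pattern_at_Stream\<close>)
  also have "Pr (Suc x) (\<lambda>\<omega>. alw (\<lambda>\<omega>. shd \<omega> \<noteq> x) \<omega> \<and> pattern_at ds y \<omega>)
      = Pr y (\<lambda>\<omega>. alw (\<lambda>\<omega>. shd \<omega> \<noteq> x) \<omega> \<and> pattern_at ds y \<omega>) / scale p x y"
    by (rule Pr_avoid, measurable) (use assms in \<open>auto simp: pattern_at_Stream\<close>)
  also have "pattern_weight x ds * (Pr y (\<lambda>\<omega>. alw (\<lambda>\<omega>. shd \<omega> \<noteq> x) \<omega> \<and> pattern_at ds y \<omega>) / scale p x y)
      \<le> pattern_weight x ds * (Pr y (pattern_at ds y) / scale p x y)"
  proof (intro mult_left_mono divide_right_mono pattern_weight_nonneg scale_nonneg)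
    show "Pr y (\<lambda>\<omega>. alw (\<lambda>\<omega>. shd \<omega> \<noteq> x) \<omega> \<and> pattern_at ds y \<omega>) \<le> Pr y (pattern_at ds y)"
      by (rule Pr_mono[OF pattern_at_measurable]) simp
  qed
  also have "Pr y (pattern_at ds y) = Pr 0 (pattern_at ds y)"
    by (rule Pr_eq_of_prefix_invariant[symmetric], measurable) (simp_all add: pattern_at_Stream)
  finally show ?thesis .
qed

end

section \<open>The limit of the scale function and its relation to \<open>D\<close>\<close>

context bd_laws
begin

text \<open>The real counterpart of \<open>Dinf\<close>, meaningful when the scale function is
  bounded; \<open>Dinf_eq\<close> gives the translation.\<close>

definition Dlim :: "nat \<Rightarrow> real" where
  "Dlim x = (SUP n. scale p x n)"

lemma scale_tendsto_Dlim:
  assumes "bdd_above (range (scale p x))"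
  shows "scale p x \<longlonglongrightarrow> Dlim x"
  unfolding Dlim_def by (rule LIMSEQ_incseq_SUP[OF assms]) (simp add: mono_def scale_mono)

lemma scale_le_Dlim: "bdd_above (range (scale p x)) \<Longrightarrow> scale p x n \<le> Dlim x"
  unfolding Dlim_def by (rule cSUP_upper) simp_all

lemma Dlim_ge_1: "bdd_above (range (scale p x)) \<Longrightarrow> 1 \<le> Dlim x"
  using scale_le_Dlim[of x "Suc x"] by simp

lemma escape_scale_le_1': "escape x * scale p x n \<le> 1"
  using escape_scale_le_1[of x n] by (cases "x \<le> n") (simp_all add: scale_def)

lemma escape_eq_Dlim:
  assumes "bdd_above (range (scale p x))"
  shows "escape x = 1 / Dlim x"
proof (rule antisym)
  have "(\<lambda>n. escape x * scale p x n) \<longlonglongrightarrow> escape x * Dlim x"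
    by (intro tendsto_intros scale_tendsto_Dlim assms)
  then have "escape x * Dlim x \<le> 1"
    by (rule LIMSEQ_le_const2) (use escape_scale_le_1' in auto)
  then show "escape x \<le> 1 / Dlim x" using Dlim_ge_1[OF assms] by (simp add: field_simps)
  show "1 / Dlim x \<le> escape x" by (rule escape_ge) (rule scale_le_Dlim[OF assms])
qed

lemma escape_eq_0:
  assumes "\<not> bdd_above (range (scale p x))"
  shows "escape x = 0"
proof (rule ccontr)
  assume "escape x \<noteq> 0"
  then have "0 < escape x" using escape_nonneg[of x] by simp
  then have "scale p x n \<le> 1 / escape x" for n
    using escape_scale_le_1'[of x n] by (simp add: field_simps)
  then show False using assms by (auto intro!: bdd_aboveI)
qed

lemma Dinf_eq: "Dinf p x = (if bdd_above (range (scale p x)) then ereal (Dlim x) else \<infinity>)"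
proof -
  have eq: "Dinf p x = (SUP n\<in>{x..}. ereal (scale p x n))"
    unfolding Dinf_def by (intro SUP_cong) (auto simp: Dmn_eq_scale)
  show ?thesis
  proof (cases "bdd_above (range (scale p x))")
    case True
    have "Dinf p x \<le> ereal (Dlim x)"
      unfolding eq by (intro SUP_least) (simp add: scale_le_Dlim[OF True])
    moreover have "ereal (Dlim x) \<le> Dinf p x"
    proof (rule LIMSEQ_le_const2)
      show "(\<lambda>n. ereal (scale p x n)) \<longlonglongrightarrow> ereal (Dlim x)"
        using scale_tendsto_Dlim[OF True] by simp
      show "\<exists>N. \<forall>n\<ge>N. ereal (scale p x n) \<le> Dinf p x"
        unfolding eq by (intro exI[of _ x] allI impI SUP_upper) simp
    qed
    ultimately show ?thesis using True by simp
  next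
    case False
    have "Dinf p x = \<infinity>"
      unfolding eq
    proof (rule SUP_PInfty)
      fix n :: nat
      have "\<exists>k. real n < scale p x k"
        using False by (auto simp: bdd_above_def not_le)
      then obtain k where "real n < scale p x k" by blast
      also have "\<dots> \<le> scale p x (max x k)" by (rule scale_mono) simp
      finally show "\<exists>i\<in>{x..}. ereal (real n) \<le> ereal (scale p x i)"
        by (intro bexI[of _ "max x k"]) auto
    qed
    then show ?thesis using False by simp
  qed
qed

text \<open>For infinite \<open>D(n)\<close> the convention \<open>1 / \<infinity> = 0\<close>
  agrees with \<open>escape n = 0\<close>, so both series conditions become conditions on escape
  probabilities.\<close>

lemma Dterm_eq_escape: "Dterm p n = escape n / ln (real n)"
  by (simp add: Dterm_def Dinf_eq escape_eq_Dlim escape_eq_0)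

lemma rho_prod_mult:
  assumes "x \<le> y" "y \<le> n"
  shows "rho_prod p x n = rho_prod p x y * rho_prod p y n"
  using assms(2) by (induction n rule: dec_induct) (use assms(1) in \<open>simp_all add: rho_prod_Suc\<close>)

lemma scale_split:
  assumes "x \<le> y" "y \<le> n"
  shows "scale p x n = scale p x y + rho_prod p x y * scale p y n"
  using assms(2)
proof (induction n rule: dec_induct)
  case (step n)
  then show ?case using assms(1) rho_prod_mult[of x y n] by (simp add: scale_Suc distrib_left)
qed simp

lemma Dlim_split:
  assumes "x \<le> y" "bdd_above (range (scale p x))" "bdd_above (range (scale p y))"
  shows "Dlim x = scale p x y + rho_prod p x y * Dlim y"
proof (rule LIMSEQ_unique[OF scale_tendsto_Dlim[OF assms(2)]])
  have "(\<lambda>n. scale p x y + rho_prod p x y * scale p y n) \<longlonglongrightarrow> scale p x y + rho_prod p x y * Dlim y"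
    by (intro tendsto_intros scale_tendsto_Dlim assms)
  moreover have "\<forall>\<^sub>F n in sequentially. scale p x y + rho_prod p x y * scale p y n = scale p x n"
    using eventually_ge_at_top[of y] by eventually_elim (rule scale_split[symmetric, OF assms(1)])
  ultimately show "scale p x \<longlonglongrightarrow> scale p x y + rho_prod p x y * Dlim y"
    by (rule Lim_transform_eventually)
qed

text \<open>With \<open>S\<close> the scale value and \<open>r\<close> its next increment,
  \<open>r / (S + r) \<le> ln (S + r) - ln S\<close>, and these differences telescope. Replacing
  \<open>S + r\<close> by \<open>S\<close> costs the factor 2, as
  \<open>r \<le> 1 \<le> S\<close>.\<close>

lemma sum_rho_prod_div_scale_le:
  assumes rho_le: "\<And>k. x < k \<Longrightarrow> rho p k \<le> 1" and "x < K"
  shows "(\<Sum>y\<in>{x<..<K}. rho_prod p x y / scale p x y) \<le> 2 * ln (scale p x K)"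
proof -
  have "Suc x \<le> K" using assms by simp
  then show ?thesis
  proof (induction K rule: dec_induct)
    case base
    have "{x<..<Suc x} = {}" by auto
    then show ?case by simp
  next
    case (step K)
    let ?S = "scale p x K" and ?r = "rho_prod p x K"
    have S: "1 \<le> ?S" using scale_ge_1[of x K] step by simp
    have r: "0 \<le> ?r" "?r \<le> 1" using rho_prod_nonneg rho_prod_le_1 rho_le by auto
    have "ln (?S / (?S + ?r)) \<le> ?S / (?S + ?r) - 1"
      using S r by (intro ln_le_minus_one) auto
    also have "\<dots> = - (?r / (?S + ?r))" using S r by (simp add: field_simps)
    finally have "?r / (?S + ?r) \<le> ln (?S + ?r) - ln ?S" using S r by (simp add: ln_div)
    moreover have "?r / ?S \<le> 2 * (?r / (?S + ?r))"
    proof -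
      have "?r * (?S + ?r) \<le> ?r * (2 * ?S)" using S r by (intro mult_left_mono) auto
      then show ?thesis using S r by (simp add: field_simps)
    qed
    ultimately have "?r / ?S \<le> 2 * ln (?S + ?r) - 2 * ln ?S" by simp
    moreover have "{x<..<Suc K} = insert K {x<..<K}" using step by auto
    ultimately show ?case using step.IH step.hyps by (simp add: scale_Suc)
  qed
qed

text \<open>The weights \<open>1 / ln x\<close> absorb the logarithmic sum of the correlations, so
  the weighted second moment is of the order of the squared mean. This yields positive probability,
  which the zero-one law raises to 1.\<close>

theorem infinitely_many_site_types:
  assumes rho: "\<And>k. n1 \<le> k \<Longrightarrow> 1 / 2 \<le> rho p k \<and> rho p k \<le> 1"
    and bdd: "\<And>x. n1 \<le> x \<Longrightarrow> bdd_above (range (scale p x))"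
    and growth: "\<And>x. n1 \<le> x \<Longrightarrow> ln (Dlim x) \<le> C * ln (real x)" and "0 \<le> C"
    and div: "\<not> summable (\<lambda>n. escape (n + 2) / ln (real (n + 2)))"
    and ab: "1 \<le> b" "b \<le> a"
  shows "AE \<omega> in Q 0. infinite {x. site_type a b x \<omega>}"
proof -
  \<comment> \<open>Together with the final departure, \<open>a - b\<close> loops down and
    \<open>b - 1\<close> loops up make \<open>a\<close> visits and \<open>b\<close>
    upcrossings.\<close>
  define ds where "ds = replicate (a - b) False @ replicate (b - 1) True"
  have ds: "Suc (length ds) = a" "Suc (length (filter id ds)) = b"
    using ab by (auto simp: ds_def)
  \<comment> \<open>The 3 exceeds \<open>exp 1\<close>, so \<open>ln x \<ge> 1\<close> and the
    weights are at most 1; \<open>Suc n1\<close> keeps \<open>x - 1\<close> in the range where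
    \<open>rho\<close> is controlled.\<close>
  define x0 where "x0 = max 3 (Suc n1)"
  define \<theta> where "\<theta> x = (if x0 \<le> x then 1 / ln (real x) else 0)" for x
  define P where "P x = Pr 0 (pattern_at ds x)" for x
  define t where "t x y = rho_prod p x y / scale p x y" for x y
  define m where "m K = (\<Sum>x<K. \<theta> x * P x)" for K
  let ?c = "(1 / 8) ^ length ds * (1 / 2) :: real"
  have ln_ge_1: "1 \<le> ln (real x)" if "x0 \<le> x" for x
  proof -
    have "exp 1 \<le> real x" using exp_le that by (simp add: x0_def)
    then show ?thesis using that by (simp add: ln_ge_iff x0_def)
  qed
  have \<theta>_nonneg: "0 \<le> \<theta> x" and \<theta>_le_1: "\<theta> x \<le> 1" for x
    using ln_ge_1[of x] by (auto simp: \<theta>_def)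
  have \<theta>_antimono: "\<theta> y \<le> \<theta> x" if "x0 \<le> x" "x < y" for x y
    using that ln_ge_1[of x] ln_ge_1[of y] by (auto simp: \<theta>_def x0_def intro!: divide_left_mono)
  have P_nonneg: "0 \<le> P x" for x by (simp add: P_def Pr_nonneg)
  have P_eq: "P x = pattern_weight x ds / Dlim x" if "x0 \<le> x" for x
    using that Pr_pattern_at[of x ds] escape_eq_Dlim[OF bdd[of x]] by (simp add: P_def x0_def)
  have D1: "1 \<le> Dlim x" if "x0 \<le> x" for x using that by (intro Dlim_ge_1 bdd) (simp add: x0_def)
  have t_nonneg: "0 \<le> t x y" for x y by (simp add: t_def rho_prod_nonneg scale_nonneg)

  \<comment> \<open>The factor 2 serves the case \<open>y = x + 1\<close>, where
    \<open>t x y = rho p y \<ge> 1 / 2\<close> makes the right-hand side at least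
    \<open>P x\<close>.\<close>
  have pair: "Pr 0 (\<lambda>\<omega>. pattern_at ds x \<omega> \<and> pattern_at ds y \<omega>) \<le> P x * (P y + 2 * t x y)"
    if "x0 \<le> x" "x < y" for x y
  proof (cases "y = Suc x")
    case True
    have "1 / 2 \<le> t x y"
      using rho[of "Suc x"] that by (simp add: True t_def rho_prod_Suc x0_def)
    then have "P x * 1 \<le> P x * (P y + 2 * t x y)"
      using P_nonneg[of y] by (intro mult_left_mono P_nonneg) simp
    moreover have "Pr 0 (\<lambda>\<omega>. pattern_at ds x \<omega> \<and> pattern_at ds y \<omega>) \<le> P x"
      unfolding P_def by (rule Pr_mono[OF pattern_at_measurable]) simp
    ultimately show ?thesis by simp
  next
    case False
    have S: "1 \<le> scale p x y" using scale_ge_1[OF that(2)] .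
    have y: "x0 \<le> y" using that by simp
    have Dx: "Dlim x = scale p x y + rho_prod p x y * Dlim y"
      using that y by (intro Dlim_split bdd) (auto simp: x0_def)
    have "Pr 0 (\<lambda>\<omega>. pattern_at ds x \<omega> \<and> pattern_at ds y \<omega>)
        \<le> pattern_weight x ds * (P y / scale p x y)"
      unfolding P_def by (rule Pr_pattern_at_pair) (use that False in \<open>auto simp: x0_def\<close>)
    also have "pattern_weight x ds = P x * Dlim x" using P_eq[OF that(1)] D1[OF that(1)] by simp
    \<comment> \<open>Dividing the splitting of \<open>Dlim x\<close> by \<open>scale p x y\<close>
      gives \<open>1 + t x y * Dlim y\<close>: independence plus a correction.\<close>
    also have "P x * Dlim x * (P y / scale p x y) = P x * (P y + t x y * (Dlim y * P y))"
      using S by (simp add: Dx t_def field_simps)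
    also have "Dlim y * P y = pattern_weight y ds" using P_eq[OF y] D1[OF y] by simp
    also have "P x * (P y + t x y * pattern_weight y ds) \<le> P x * (P y + 2 * t x y)"
    proof -
      have "t x y * pattern_weight y ds \<le> t x y * 2"
        using pattern_weight_le_1[of y ds] by (intro mult_left_mono t_nonneg) simp
      then show ?thesis by (intro mult_left_mono P_nonneg) simp
    qed
    finally show ?thesis .
  qed

  have t_sum: "\<theta> x * (\<Sum>y\<in>{x<..<K}. t x y) \<le> 2 * C" if "x0 \<le> x" "x < K" for x K
  proof -
    have "(\<Sum>y\<in>{x<..<K}. t x y) \<le> 2 * ln (scale p x K)"
      unfolding t_def by (rule sum_rho_prod_div_scale_le) (use rho that in \<open>auto simp: x0_def\<close>)
    also have "\<dots> \<le> 2 * ln (Dlim x)"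
    proof -
      have "scale p x K \<le> Dlim x" using that by (intro scale_le_Dlim bdd) (simp add: x0_def)
      then show ?thesis using scale_ge_1[OF that(2)] by simp
    qed
    also have "\<dots> \<le> 2 * (C * ln (real x))" using growth[of x] that by (simp add: x0_def)
    finally have "\<theta> x * (\<Sum>y\<in>{x<..<K}. t x y) \<le> \<theta> x * (2 * (C * ln (real x)))"
      by (rule mult_left_mono) (rule \<theta>_nonneg)
    also have "\<dots> = 2 * C" using ln_ge_1[OF that(1)] that by (simp add: \<theta>_def)
    finally show ?thesis .
  qed

  interpret prob_space "Q 0" by (rule prob_space_Q)
  define A where "A x = {\<omega>. pattern_at ds x \<omega>}" for x
  have A: "A x \<in> events" for x unfolding A_def by (rule sets_Q_pred) measurable
  have PA: "prob (A x) = P x" for x by (simp add: A_def P_def Pr_def)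
  have PAA: "prob (A x \<inter> A y) = Pr 0 (\<lambda>\<omega>. pattern_at ds x \<omega> \<and> pattern_at ds y \<omega>)" for x y
    by (simp add: A_def Pr_def Collect_conj_eq)

  have row: "(\<Sum>y\<in>{x<..<K}. \<theta> x * \<theta> y * prob (A x \<inter> A y)) \<le> \<theta> x * P x * (m K + 4 * C)"
    if "x < K" for x K
  proof (cases "x0 \<le> x")
    case False
    then show ?thesis by (simp add: \<theta>_def)
  next
    case True
    have "(\<Sum>y\<in>{x<..<K}. \<theta> x * \<theta> y * prob (A x \<inter> A y))
        \<le> (\<Sum>y\<in>{x<..<K}. \<theta> x * P x * (\<theta> y * P y + 2 * \<theta> x * t x y))"
    proof (rule sum_mono)
      fix y assume y: "y \<in> {x<..<K}"
      have "\<theta> x * \<theta> y * prob (A x \<inter> A y) \<le> \<theta> x * \<theta> y * (P x * (P y + 2 * t x y))"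
        unfolding PAA using pair[OF True] y by (intro mult_left_mono mult_nonneg_nonneg \<theta>_nonneg) auto
      also have "\<dots> = \<theta> x * P x * (\<theta> y * P y + 2 * (\<theta> y * t x y))" by (simp add: algebra_simps)
      \<comment> \<open>The weights decrease, and with \<open>\<theta> x\<close> in place of
        \<open>\<theta> y\<close> the bound \<open>t_sum\<close> becomes applicable.\<close>
      also have "\<dots> \<le> \<theta> x * P x * (\<theta> y * P y + 2 * (\<theta> x * t x y))"
        using \<theta>_antimono[OF True] y
        by (intro mult_left_mono add_left_mono mult_right_mono mult_nonneg_nonneg \<theta>_nonneg P_nonneg t_nonneg) auto
      finally show "\<theta> x * \<theta> y * prob (A x \<inter> A y) \<le> \<theta> x * P x * (\<theta> y * P y + 2 * \<theta> x * t x y)"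
        by (simp add: mult.assoc)
    qed
    also have "\<dots> = \<theta> x * P x * ((\<Sum>y\<in>{x<..<K}. \<theta> y * P y) + 2 * (\<theta> x * (\<Sum>y\<in>{x<..<K}. t x y)))"
      by (simp add: sum_distrib_left sum.distrib distrib_left mult.assoc)
    also have "\<dots> \<le> \<theta> x * P x * (m K + 4 * C)"
    proof (intro mult_left_mono mult_nonneg_nonneg \<theta>_nonneg P_nonneg)
      have "(\<Sum>y\<in>{x<..<K}. \<theta> y * P y) \<le> m K"
        unfolding m_def by (rule sum_mono2) (auto simp: \<theta>_nonneg P_nonneg)
      then show "(\<Sum>y\<in>{x<..<K}. \<theta> y * P y) + 2 * (\<theta> x * (\<Sum>y\<in>{x<..<K}. t x y)) \<le> m K + 4 * C"
        using t_sum[OF True that] by simp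
    qed
    finally show ?thesis .
  qed

  \<comment> \<open>The diagonal contributes 1 and the two triangles
    \<open>2 * (m K + 4 * C)\<close>; since \<open>m K \<ge> 1\<close>, the constant part
    \<open>1 + 8 * C\<close> is at most \<open>(1 + 8 * C) * m K\<close>.\<close>
  have second: "(\<Sum>x<K. \<Sum>y<K. \<theta> x * \<theta> y * prob (A x \<inter> A y)) \<le> (3 + 8 * C) * (m K)\<^sup>2"
    if "1 \<le> m K" for K
  proof -
    have "(\<Sum>x<K. \<Sum>y<K. \<theta> x * \<theta> y * prob (A x \<inter> A y))
        = (\<Sum>x<K. \<theta> x * \<theta> x * prob (A x \<inter> A x) + 2 * (\<Sum>y\<in>{x<..<K}. \<theta> x * \<theta> y * prob (A x \<inter> A y)))"
      by (rule sum_symmetric) (simp add: Int_commute mult_ac)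
    also have "\<dots> \<le> (\<Sum>x<K. \<theta> x * P x * (1 + 8 * C + 2 * m K))"
    proof (rule sum_mono)
      fix x assume "x \<in> {..<K}"
      then have "(\<Sum>y\<in>{x<..<K}. \<theta> x * \<theta> y * prob (A x \<inter> A y)) \<le> \<theta> x * P x * (m K + 4 * C)"
        by (intro row) simp
      moreover have "\<theta> x * \<theta> x * prob (A x \<inter> A x) \<le> \<theta> x * 1 * P x"
        unfolding Int_absorb PA by (intro mult_right_mono mult_left_mono \<theta>_le_1 \<theta>_nonneg P_nonneg)
      ultimately show "\<theta> x * \<theta> x * prob (A x \<inter> A x) + 2 * (\<Sum>y\<in>{x<..<K}. \<theta> x * \<theta> y * prob (A x \<inter> A y))
          \<le> \<theta> x * P x * (1 + 8 * C + 2 * m K)"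
        by (simp add: algebra_simps)
    qed
    also have "\<dots> = m K * (1 + 8 * C + 2 * m K)" by (simp add: m_def sum_distrib_right)
    also have "\<dots> \<le> m K * ((3 + 8 * C) * m K)"
    proof (rule mult_left_mono)
      have "(1 + 8 * C) * 1 \<le> (1 + 8 * C) * m K" using that \<open>0 \<le> C\<close> by (intro mult_left_mono) auto
      then show "1 + 8 * C + 2 * m K \<le> (3 + 8 * C) * m K" by (simp add: algebra_simps)
    qed (use that in simp)
    finally show ?thesis by (simp add: power2_eq_square mult_ac)
  qed

  \<comment> \<open>\<open>P x\<close> is at least \<open>?c * escape x\<close>, so convergence
    would carry over to the divergent series of escape probabilities.\<close>
  have diverge: "\<not> summable (\<lambda>n. \<theta> n * prob (A n))"
  proof
    assume "summable (\<lambda>n. \<theta> n * prob (A n))"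
    then have "summable (\<lambda>n. 1 / ?c * (\<theta> n * P n))" unfolding PA by (rule summable_mult)
    then have "summable (\<lambda>n. escape n / ln (real n))"
    proof (rule summable_comparison_test_ev[rotated])
      show "\<forall>\<^sub>F n in sequentially. norm (escape n / ln (real n)) \<le> 1 / ?c * (\<theta> n * P n)"
        using eventually_ge_at_top[of x0]
      proof eventually_elim
        fix n assume n: "x0 \<le> n"
        have "?c \<le> pattern_weight n ds" 
          using pattern_weight_ge[of n1 n ds] rho n by (simp add: x0_def)
        then have "?c * escape n \<le> pattern_weight n ds * escape n" by (rule mult_right_mono) (rule escape_nonneg)
        also have "\<dots> = P n" using Pr_pattern_at[of n ds] n by (simp add: P_def x0_def)
        finally have "?c * escape n \<le> P n" .
        then have "escape n \<le> 1 / ?c * P n" by (simp add: field_simps)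
        then have "\<theta> n * escape n \<le> \<theta> n * (1 / ?c * P n)" by (rule mult_left_mono) (rule \<theta>_nonneg)
        then show "norm (escape n / ln (real n)) \<le> 1 / ?c * (\<theta> n * P n)"
          using n ln_ge_1[OF n] escape_nonneg[of n] by (simp add: \<theta>_def mult.commute)
      qed
    qed
    then show False using div summable_iff_shift[of "\<lambda>n. escape n / ln (real n)" 2] by simp
  qed

  have "prob {\<omega>\<in>space (Q 0). infinite {n. \<omega> \<in> A n}} \<noteq> 0"
    by (rule prob_infinitely_often_nonzero[OF A \<theta>_nonneg _ diverge _ second])
       (use \<open>0 \<le> C\<close> in \<open>auto simp: m_def PA\<close>)
  then have pos: "Pr 0 (\<lambda>\<omega>. infinite {x. pattern_at ds x \<omega>}) \<noteq> 0" by (simp add: Pr_def A_def)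
  have meas: "Measurable.pred path_space (\<lambda>\<omega>. infinite {x. site_type a b x \<omega>})" by measurable
  have "Pr 0 (\<lambda>\<omega>. infinite {x. pattern_at ds x \<omega>}) \<le> Pr 0 (\<lambda>\<omega>. infinite {x. site_type a b x \<omega>})"
  proof (rule Pr_mono[OF meas])
    fix \<omega> assume inf: "infinite {x. pattern_at ds x \<omega>}"
    \<comment> \<open>Site 0 is set aside because a loop through \<open>0 - 1 = 0\<close> would be
      no loop.\<close>
    have "{x. pattern_at ds x \<omega>} \<subseteq> insert 0 {x. site_type a b x \<omega>}"
      using pattern_at_site_type[of _ ds \<omega>] by (auto simp: ds Suc_le_eq)
    then show "infinite {x. site_type a b x \<omega>}" using inf finite_subset by blast
  qed
  then have "Pr 0 (\<lambda>\<omega>. infinite {x. site_type a b x \<omega>}) \<noteq> 0"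
    using pos Pr_nonneg[of 0 "\<lambda>\<omega>. infinite {x. pattern_at ds x \<omega>}"] by linarith
  then have "Pr 0 (\<lambda>\<omega>. infinite {x. site_type a b x \<omega>}) = 1"
    by (rule shift_invariant_zero_one[OF meas infinite_site_type_Stream])
  then show ?thesis by (simp only: AE_iff_Pr_eq_1[OF meas])
qed

text \<open>A nearest-neighbour path from 0 cannot pass \<open>x\<close> without visiting it: before
  its only visit it is below \<open>x\<close>, and having left upwards it stays above.\<close>

lemma AE_site_type_weak_cut: "AE \<omega> in Q 0. \<forall>x. site_type 1 1 x \<omega> \<longrightarrow> weak_cut x \<omega>"
  using AE_start[of 0] AE_nearest_neighbour[of 0]
proof eventually_elim
  fix \<omega> :: "nat stream"
  assume start: "shd \<omega> = 0"
    and nn: "\<forall>k. \<omega> !! Suc k = Suc (\<omega> !! k) \<or> \<omega> !! Suc k = \<omega> !! k - 1"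
  show "\<forall>x. site_type 1 1 x \<omega> \<longrightarrow> weak_cut x \<omega>"
  proof (intro allI impI)
    fix x assume st: "site_type 1 1 x \<omega>"
    obtain k where k: "visits x \<omega> = {k}" using st unfolding site_type_def by (auto simp: card_1_singleton_iff)
    obtain j where j: "ups x \<omega> = {j}" using st unfolding site_type_def by (auto simp: card_1_singleton_iff)
    have "j \<in> visits x \<omega>" using j unfolding ups_def visits_def by blast
    then have "j = k" using k by simp
    then have up: "\<omega> !! k = x" "\<omega> !! Suc k = Suc x" using j unfolding ups_def by blast+
    have ne: "\<omega> !! i \<noteq> x" if "i \<noteq> k" for i using k that unfolding visits_def by blast
    have after: "x < \<omega> !! i" if "Suc k \<le> i" for i
      using that
    proof (induction i rule: dec_induct)
      case base then show ?case using up by simp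
    next
      case (step i)
      have "\<omega> !! Suc i = Suc (\<omega> !! i) \<or> \<omega> !! Suc i = \<omega> !! i - 1" using nn by blast
      then show ?case using step ne[of "Suc i"] by linarith
    qed
    have before: "\<omega> !! i \<le> x" if "i \<le> k" for i
      using that
    proof (induction i)
      case 0 then show ?case using start by simp
    next
      case (Suc i)
      have "\<omega> !! Suc i = Suc (\<omega> !! i) \<or> \<omega> !! Suc i = \<omega> !! i - 1" using nn by blast
      then show ?case using Suc ne[of i] by linarith
    qed
    show "weak_cut x \<omega>"
      unfolding weak_cut_def
    proof (intro exI[of _ k] conjI allI impI)
      show "\<omega> !! k = x" by (rule up)
      show "\<omega> !! i \<in> {..x}" if "i < k" for i using before[of i] that by simp
      show "\<omega> !! i \<in> {x..}" if "k < i" for i using after[of i] that by simp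
    qed
  qed
qed

end

section \<open>Transfer of both alternatives to the given chain\<close>

theorem theorem1:
  fixes M :: "'a measure" and p :: "nat \<Rightarrow> real" and X :: "nat \<Rightarrow> 'a \<Rightarrow> nat"
  assumes p0: "p 0 = 1"
    and p_pos: "\<And>k. k \<ge> 1 \<Longrightarrow> 0 < p k \<and> p k < 1"
    and chain: "bd_chain M p X"
    and mono: "\<exists>N0>0. \<forall>k j. N0 < k \<longrightarrow> k \<le> j \<longrightarrow> rho p k \<le> rho p j"
    and lim: "rho p \<longlonglongrightarrow> 1"
  shows
    "(summable (\<lambda>n. Dterm p (n + 2)) \<longrightarrow>
       (\<forall>a A B. a \<ge> 1 \<longrightarrow> A \<subseteq> {a..} \<longrightarrow> B \<subseteq> {1..a} \<longrightarrow>
          (AE \<omega> in M. finite (Cset X A {a} \<omega>) \<and> finite (Cset X {a} B \<omega>) \<and> finite (Cw X \<omega>))))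
     \<and>
     ((\<exists>n0>0. \<exists>\<delta>>0. \<forall>n\<ge>n0. Dinf p n \<le> ereal (\<delta> * real n * ln (real n))) \<and>
       \<not> summable (\<lambda>n. Dterm p (n + 2)) \<longrightarrow>
       (\<forall>a A B. a \<ge> 1 \<longrightarrow> A \<subseteq> {a..} \<longrightarrow> A \<noteq> {} \<longrightarrow> B \<subseteq> {1..a} \<longrightarrow> B \<noteq> {} \<longrightarrow>
          (AE \<omega> in M. infinite (Cset X A {a} \<omega>) \<and> infinite (Cset X {a} B \<omega>) \<and> infinite (Cw X \<omega>))))"
proof -
  interpret P: bd_process M p X
    using chain p0 p_pos by unfold_locales auto
  interpret L: bd_laws p P.Q
    by (rule P.bd_laws_Q)
  have transfer: "AE \<omega> in M. \<phi> (to_stream (\<lambda>k. X k \<omega>))"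
    if "Measurable.pred path_space \<phi>" "AE \<omega> in P.Q 0. \<phi> \<omega>" for \<phi>
    by (rule P.AE_future_0[OF that(1)])
       (use that(2) in \<open>simp add: L.AE_iff_Pr_eq_1[OF that(1)] L.Pr_def\<close>)
  have visits: "visits x (to_stream (\<lambda>k. X k \<omega>)) = {k. X k \<omega> = x}"
    and ups: "ups x (to_stream (\<lambda>k. X k \<omega>)) = {k. X k \<omega> = x \<and> X (Suc k) \<omega> = Suc x}" for x \<omega>
    by (simp_all add: visits_def ups_def to_stream_def)
  have Cw: "Cw X \<omega> = {x. weak_cut x (to_stream (\<lambda>k. X k \<omega>))}" for \<omega>
    by (auto simp: Cw_def weak_cut_def to_stream_def)
  obtain N0 where N0: "\<And>k j. N0 < k \<Longrightarrow> k \<le> j \<Longrightarrow> rho p k \<le> rho p j" using mono by blast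
  \<comment> \<open>A sequence that is nondecreasing beyond \<open>N0\<close> and converges to 1
    cannot exceed 1 there.\<close>
  have rho_le: "rho p k \<le> 1" if "N0 < k" for k
    by (rule LIMSEQ_le_const[OF lim]) (use N0[OF that] in blast)
  have Dterm: "Dterm p (n + 2) = L.escape (n + 2) / ln (real (n + 2))" for n
    by (rule L.Dterm_eq_escape)
  have part1: "AE \<omega> in M. finite (Cset X A {a} \<omega>) \<and> finite (Cset X {a} B \<omega>) \<and> finite (Cw X \<omega>)"
    if sum: "summable (\<lambda>n. Dterm p (n + 2))" and B: "B \<subseteq> {1..a}" for a A B
  proof -
    have sum': "summable (\<lambda>n. L.escape (n + 2) / ln (real (n + 2)))" using sum unfolding Dterm .
    have rho_le': "rho p k \<le> 1" if "Suc N0 \<le> k" for k using rho_le that by simp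
    have "AE \<omega> in M. finite {n. has_ups b n (to_stream (\<lambda>k. X k \<omega>))}" for b
      by (rule transfer[OF _ L.finitely_many_has_ups_and_weak_cut(1)[OF rho_le' sum']]) measurable
    then have "AE \<omega> in M. \<forall>b. finite {n. has_ups b n (to_stream (\<lambda>k. X k \<omega>))}"
      by (simp add: AE_all_countable)
    moreover have "AE \<omega> in M. finite {n. weak_cut n (to_stream (\<lambda>k. X k \<omega>))}"
      by (rule transfer[OF _ L.finitely_many_has_ups_and_weak_cut(2)[OF rho_le' sum']]) measurable
    ultimately show ?thesis
    proof eventually_elim
      fix \<omega>
      assume u: "\<forall>b. finite {n. has_ups b n (to_stream (\<lambda>k. X k \<omega>))}"
        and w: "finite {n. weak_cut n (to_stream (\<lambda>k. X k \<omega>))}"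
      \<comment> \<open>In both kinds of sets the upcrossing number is confined to finitely many
        values, the value \<open>a\<close> or the finite set \<open>B\<close>, so the visit counts
        can be ignored.\<close>
      have "Cset X A {a} \<omega> \<subseteq> {n. has_ups a n (to_stream (\<lambda>k. X k \<omega>))}"
        by (auto simp: Cset_def has_ups_def ups)
      moreover have "Cset X {a} B \<omega> \<subseteq> (\<Union>b\<in>B. {n. has_ups b n (to_stream (\<lambda>k. X k \<omega>))})"
        by (auto simp: Cset_def has_ups_def ups)
      moreover have "finite B" using B finite_subset by blast
      ultimately show "finite (Cset X A {a} \<omega>) \<and> finite (Cset X {a} B \<omega>) \<and> finite (Cw X \<omega>)"
        using u w unfolding Cw by (metis (no_types, lifting) finite_UN finite_subset)
    qed
  qed
  have part2: "AE \<omega> in M. infinite (Cset X A {a} \<omega>) \<and> infinite (Cset X {a} B \<omega>) \<and> infinite (Cw X \<omega>)"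
    if bound: "\<forall>n\<ge>n0. Dinf p n \<le> ereal (\<delta> * real n * ln (real n))" and "\<delta> > 0"
      and div: "\<not> summable (\<lambda>n. Dterm p (n + 2))" and "1 \<le> a"
      and A: "A \<subseteq> {a..}" "A \<noteq> {}" and B: "B \<subseteq> {1..a}" "B \<noteq> {}" for n0 \<delta> a A B
  proof -
    have div': "\<not> summable (\<lambda>n. L.escape (n + 2) / ln (real (n + 2)))" using div unfolding Dterm .
    have "\<forall>\<^sub>F k in sequentially. 1 / 2 < rho p k" by (rule order_tendstoD[OF lim]) simp
    then obtain N1 where N1: "\<And>k. N1 \<le> k \<Longrightarrow> 1 / 2 < rho p k" by (auto simp: eventually_sequentially)
    \<comment> \<open>The entries ensure in turn \<open>ln x \<ge> 1\<close>,
      \<open>rho \<le> 1\<close>, \<open>rho \<ge> 1 / 2\<close> and the growth bound on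
      \<open>D\<close>.\<close>
    define n1 where "n1 = Max {3, Suc N0, N1, n0}"
    have n1: "3 \<le> n1" "N0 < n1" "N1 \<le> n1" "n0 \<le> n1" by (auto simp: n1_def)
    have rho: "1 / 2 \<le> rho p k \<and> rho p k \<le> 1" if "n1 \<le> k" for k
      using N1[of k] rho_le[of k] n1 that by auto
    have fin: "bdd_above (range (scale p x)) \<and> L.Dlim x \<le> \<delta> * real x * ln (real x)" if "n1 \<le> x" for x
      using bound[rule_format, of x] n1 that by (auto simp: L.Dinf_eq split: if_splits)
    \<comment> \<open>Expand \<open>ln (\<delta> * x * ln x)\<close>; as
      \<open>ln x \<ge> 1\<close>, each of the terms \<open>\<bar>ln \<delta>\<bar>\<close>,
      \<open>ln x\<close> and \<open>ln (ln x)\<close> is at most a multiple of \<open>ln x\<close>,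
      with factors \<open>\<bar>ln \<delta>\<bar>\<close>, 1 and 1.\<close>
    have growth: "ln (L.Dlim x) \<le> (\<bar>ln \<delta>\<bar> + 2) * ln (real x)" if "n1 \<le> x" for x
    proof -
      have "exp 1 \<le> real x" using exp_le n1 that by simp
      then have ln1: "1 \<le> ln (real x)" using n1 that by (simp add: ln_ge_iff)
      have "ln (L.Dlim x) \<le> ln (\<delta> * real x * ln (real x))"
        using fin[OF that] L.Dlim_ge_1[of x] by (intro ln_mono) auto
      also have "\<dots> = ln \<delta> + ln (real x) + ln (ln (real x))"
        using \<open>\<delta> > 0\<close> n1 that ln1 by (simp add: ln_mult)
      also have "\<dots> \<le> \<bar>ln \<delta>\<bar> * ln (real x) + ln (real x) + ln (real x)"
      proof -
        have "ln \<delta> \<le> \<bar>ln \<delta>\<bar> * 1" by simp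
        also have "\<dots> \<le> \<bar>ln \<delta>\<bar> * ln (real x)" using ln1 by (intro mult_left_mono) auto
        finally have "ln \<delta> \<le> \<bar>ln \<delta>\<bar> * ln (real x)" .
        moreover have "ln (ln (real x)) \<le> ln (real x)" using ln1 ln_le_minus_one[of "ln (real x)"] by simp
        ultimately show ?thesis by simp
      qed
      finally show ?thesis by (simp add: algebra_simps)
    qed
    have Q_inf: "AE \<omega> in P.Q 0. infinite {x. site_type a' b' x \<omega>}" if "1 \<le> b'" "b' \<le> a'" for a' b'
      by (rule L.infinitely_many_site_types[OF rho _ growth _ div' that]) (use fin in auto)
    have M_inf: "AE \<omega> in M. infinite {x. site_type a' b' x (to_stream (\<lambda>k. X k \<omega>))}"
      if "1 \<le> b'" "b' \<le> a'" for a' b'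
      by (rule transfer[OF _ Q_inf[OF that]]) measurable
    \<comment> \<open>Sites visited once and left upwards already supply infinitely many weak
      cutpoints.\<close>
    have "AE \<omega> in P.Q 0. infinite {x. weak_cut x \<omega>}"
      using Q_inf[of 1 1, OF order_refl order_refl] L.AE_site_type_weak_cut
    proof eventually_elim
      fix \<omega> assume inf: "infinite {x. site_type 1 1 x \<omega>}" and *: "\<forall>x. site_type 1 1 x \<omega> \<longrightarrow> weak_cut x \<omega>"
      show "infinite {x. weak_cut x \<omega>}" by (rule infinite_super[OF _ inf]) (use * in blast)
    qed
    then have weak: "AE \<omega> in M. infinite {x. weak_cut x (to_stream (\<lambda>k. X k \<omega>))}"
      by (intro transfer) measurable
    \<comment> \<open>One element of each set suffices: sites with \<open>a'\<close> visits and
      \<open>a\<close> upcrossings, and sites with \<open>a\<close> visits and \<open>b\<close>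
      upcrossings.\<close>
    obtain a' where a': "a' \<in> A" "a \<le> a'" using A by auto
    obtain b where b: "b \<in> B" "1 \<le> b" "b \<le> a" using B by (metis atLeastAtMost_iff ex_in_conv subsetD)
    show ?thesis
      using M_inf[OF \<open>1 \<le> a\<close> a'(2)] M_inf[OF b(2,3)] weak
    proof eventually_elim
      fix \<omega>
      assume inf1: "infinite {x. site_type a' a x (to_stream (\<lambda>k. X k \<omega>))}"
        and inf2: "infinite {x. site_type a b x (to_stream (\<lambda>k. X k \<omega>))}"
        and inf3: "infinite {x. weak_cut x (to_stream (\<lambda>k. X k \<omega>))}"
      have "infinite (Cset X A {a} \<omega>)"
        by (rule infinite_super[OF _ inf1]) (use a' in \<open>auto simp: Cset_def site_type_def visits ups\<close>)
      moreover have "infinite (Cset X {a} B \<omega>)"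
        by (rule infinite_super[OF _ inf2]) (use b in \<open>auto simp: Cset_def site_type_def visits ups\<close>)
      ultimately show "infinite (Cset X A {a} \<omega>) \<and> infinite (Cset X {a} B \<omega>) \<and> infinite (Cw X \<omega>)"
        using inf3 unfolding Cw by blast
    qed
  qed
  show ?thesis
  proof (rule conjI; intro impI allI)
    fix a :: nat and A B :: "nat set"
    assume "summable (\<lambda>n. Dterm p (n + 2))" "B \<subseteq> {1..a}"
    then show "AE \<omega> in M. finite (Cset X A {a} \<omega>) \<and> finite (Cset X {a} B \<omega>) \<and> finite (Cw X \<omega>)"
      by (rule part1)
  next
    fix a :: nat and A B :: "nat set"
    assume h: "(\<exists>n0>0. \<exists>\<delta>>0. \<forall>n\<ge>n0. Dinf p n \<le> ereal (\<delta> * real n * ln (real n))) \<and>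
        \<not> summable (\<lambda>n. Dterm p (n + 2))"
      and ab: "1 \<le> a" "A \<subseteq> {a..}" "A \<noteq> {}" "B \<subseteq> {1..a}" "B \<noteq> {}"
    from h obtain n0 \<delta> where "\<forall>n\<ge>n0. Dinf p n \<le> ereal (\<delta> * real n * ln (real n))" "\<delta> > 0" by blast
    then show "AE \<omega> in M. infinite (Cset X A {a} \<omega>) \<and> infinite (Cset X {a} B \<omega>) \<and> infinite (Cw X \<omega>)"
      using h ab by (intro part2) simp_all
  qed
qed

end
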